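(* For every integer $n\geq 3$ there exists a constant $\theta_n>0$, depending only on $n$, such that the following holds. Let $Q$ be an $n$-polygon in the plane with $n$ vertices (not necessarily distinct), such that each edge is of length one and the distance between any two distinct vertices is at least one. Then there exists a diagonal triangulation of $Q$ such that all interior angles of its triangles are at least $\theta_n$.
   Context: An $n$-polygon $Q$ in the plane is a bounded closed subset of $\mathbb{R}^2$, equal to the closure of its interior, such that the boundary $\partial Q$ consists of $n$ segments and there is a surjective immersion from the circle $S^1$ to $\partial Q$ for which the preimage of any interior point of every segment is exactly one point. The segments are called the edges of $Q$. The endpoints of the segments have $n$ preimages in $S^1$ in total; the endpoints, labelled according to their preimages, are called the vertices of $Q$. Thus $Q$ has $n$ edges and $n$ vertices, and vertices with different labels may coincide as points of the plane ("distinct vertices" in the distance condition means vertices that are distinct as points). Let $V$ be the set of vertices of $Q$. For two vertices $v,w$, a segment $[v,w]\subset Q$ that is not an edge of $Q$ and satisfies $[v,w]\cap V=\{v,w\}$ is called a diagonal segment. A triangulation of the $n$-polygon $Q$ (into non-degenerate triangles) is called a diagonal triangulation if the edges of the resulting triangles consist of edges and diagonal segments of $Q$. *)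

theory Defs
  imports "HOL-Analysis.Analysis"
begin

(* The boundary curve of a polygon has corners, so "immersion" of the circle can only be
   meant topologically: continuous and locally injective. *)
definition topological_immersion_on ::
    "'a::topological_space set \<Rightarrow> ('a \<Rightarrow> 'b::topological_space) \<Rightarrow> bool" where
  "topological_immersion_on S f \<longleftrightarrow>
     continuous_on S f \<and>
     (\<forall>t\<in>S. \<exists>U. openin (top_of_set S) U \<and> t \<in> U \<and> inj_on f U)"

definition segment_endpoints :: "(real^2) set set \<Rightarrow> (real^2) set" where
  "segment_endpoints E = {a. \<exists>b. closed_segment a b \<in> E}"

(* An n-polygon Q is taken together with its set E of edges, since Q alone does not determine
   them: a vertex may have interior angle pi.  That the boundary consists of the n segments
   includes that they do not overlap.  The elements of the preimage of segment_endpoints E under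
   g are the n labelled vertices; segment_endpoints E is the set of vertices as points of the
   plane and may have fewer than n elements. *)
definition n_polygon :: "nat \<Rightarrow> (real^2) set \<Rightarrow> (real^2) set set \<Rightarrow> bool" where
  "n_polygon n Q E \<longleftrightarrow>
     bounded Q \<and> closed Q \<and> Q = closure (interior Q) \<and>
     finite E \<and> card E = n \<and>
     (\<forall>e\<in>E. \<exists>a b. a \<noteq> b \<and> e = closed_segment a b) \<and>
     (\<forall>e\<in>E. \<forall>e'\<in>E. e \<noteq> e' \<longrightarrow> rel_interior e \<inter> rel_interior e' = {}) \<and>
     \<Union>E = frontier Q \<and>
     (\<exists>g :: real^2 \<Rightarrow> real^2.
        topological_immersion_on (sphere 0 1) g \<and>
        g ` sphere 0 1 = frontier Q \<and>
        (\<forall>e\<in>E. \<forall>x\<in>rel_interior e. \<exists>!t. t \<in> sphere 0 1 \<and> g t = x) \<and>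
        card {t \<in> sphere 0 1. g t \<in> segment_endpoints E} = n)"

definition diagonal_segment :: "(real^2) set \<Rightarrow> (real^2) set set \<Rightarrow> (real^2) set \<Rightarrow> bool" where
  "diagonal_segment Q E s \<longleftrightarrow>
     (\<exists>v\<in>segment_endpoints E. \<exists>w\<in>segment_endpoints E.
        v \<noteq> w \<and> s = closed_segment v w \<and> s \<subseteq> Q \<and> s \<notin> E \<and>
        s \<inter> segment_endpoints E = {v, w})"

definition diagonal_triangulation ::
    "(real^2) set \<Rightarrow> (real^2) set set \<Rightarrow> (real^2) set set \<Rightarrow> bool" where
  "diagonal_triangulation Q E \<T> \<longleftrightarrow>
     triangulation \<T> \<and> (\<forall>T\<in>\<T>. 2 simplex T) \<and> \<Union>\<T> = Q \<and>
     (\<forall>T\<in>\<T>. \<forall>s. s edge_of T \<longrightarrow> s \<in> E \<or> diagonal_segment Q E s)"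

(* The angle at b between the rays from b through a and from b through c. *)
definition angle_at :: "real^2 \<Rightarrow> real^2 \<Rightarrow> real^2 \<Rightarrow> real" where
  "angle_at a b c = arccos (((a - b) \<bullet> (c - b)) / (norm (a - b) * norm (c - b)))"

end

theory Submission
  imports Defs
begin

text \<open>Among all triangulations of \<open>Q\<close> with vertices in the vertex set \<open>V\<close>, one
that minimises \<open>\<Sum> area(T) * (sum of |v|^2 over the corners v of T)\<close> is locally Delaunay:
this sum is, up to a factor, the volume below the piecewise linear interpolation of the paraboloid \<open>z =
|x|^2\<close>, and flipping the diagonal of two neighbouring triangles whose angles opposite to the common
side add up to more than \<open>\<pi>\<close> lowers it (\<open>flip_tiling\<close>).

A locally Delaunay triangulation has no very thin triangle (\<open>thin_triangles_propagate\<close>). All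
sides have length between \<open>1\<close> and \<open>n\<close>, the upper bound because the boundary is a
connected union of \<open>n\<close> unit segments. So a triangle of tiny area has an angle close to
\<open>\<pi>\<close>, its longest side is longer than \<open>1\<close>, and hence this side is not an edge of
\<open>Q\<close>. By the local Delaunay property the angle opposite to it in the triangle on the other side is
close to \<open>0\<close>. That triangle is therefore again thin, its area is larger by a factor of at most
\<open>2 n^2\<close>, and its obtuse corner lies on the common side, so that its longest side is longer than
the previous one by a definite amount. After \<open>n^2 + 1\<close> steps the sides exceed the diameter. The
areas are thus bounded below in terms of \<open>n\<close>, and with bounded sides this bounds the angles.

There remains the existence of a triangulation (\<open>tiling_exists\<close>). A triangle is called clean if
its corners are its only points in \<open>V\<close>. Finitely many clean triangles with disjoint interiors
automatically meet face to face (\<open>clean_triangles_face_to_face\<close>), so it is enough to tile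
\<open>Q\<close> by clean triangles. Take a maximal set \<open>G\<close> of non-crossing segments that
contains the edges. Around a generic point \<open>p\<close> of \<open>Q\<close>, a triangle of least area
among those that contain \<open>p\<close> and have corners visible from \<open>p\<close> turns out to be clean
and to have no point of \<open>G\<close> inside. Its sides belong to \<open>G\<close> by maximality, and
therefore the triangles obtained from two generic points have disjoint interiors or coincide.\<close>

section \<open>Orientation of plane triangles\<close>

text \<open>Twice the signed area: positive if \<open>a\<close>, \<open>b\<close>, \<open>c\<close> are in
counterclockwise order.\<close>

definition orient :: "real^2 \<Rightarrow> real^2 \<Rightarrow> real^2 \<Rightarrow> real" where
  "orient a b c = (b$1 - a$1) * (c$2 - a$2) - (b$2 - a$2) * (c$1 - a$1)"

lemma orient_cycle: "orient b c a = orient a b c"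
  by (simp add: orient_def algebra_simps)

lemma orient_swap: "orient b a c = - orient a b c"
  by (simp add: orient_def algebra_simps)

lemma orient_swap_right: "orient a c b = - orient a b c"
  by (simp add: orient_def algebra_simps)

lemma orient_degenerate [simp]: "orient a a x = 0" "orient a x a = 0" "orient a x x = 0"
  by (simp_all add: orient_def)

lemma orient_segment:
  "orient a b ((1 - t) *\<^sub>R x + t *\<^sub>R y) = (1 - t) * orient a b x + t * orient a b y"
  by (simp add: orient_def algebra_simps)

lemma orient_combination:
  assumes "u + v + w = 1"
  shows "orient p q (u *\<^sub>R a + v *\<^sub>R b + w *\<^sub>R c) = u * orient p q a + v * orient p q b + w * orient p q c"
proof -
  have u: "u = 1 - v - w" using assms by simp
  show ?thesis by (simp add: orient_def u algebra_simps)
qed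

lemma orient_split: "orient a b c = orient p a b + orient p b c + orient p c a"
  by (simp add: orient_def algebra_simps)

lemma barycentric_coordinates:
  assumes "orient a b c \<noteq> 0"
  shows "x = (orient b c x / orient a b c) *\<^sub>R a + (orient c a x / orient a b c) *\<^sub>R b
           + (orient a b x / orient a b c) *\<^sub>R c"
proof -
  have "orient a b c *\<^sub>R x = orient b c x *\<^sub>R a + orient c a x *\<^sub>R b + orient a b x *\<^sub>R c"
    by (simp add: vec_eq_iff forall_2 orient_def algebra_simps)
  then have "x = (1 / orient a b c) *\<^sub>R (orient b c x *\<^sub>R a + orient c a x *\<^sub>R b + orient a b x *\<^sub>R c)"
    using assms by (metis divide_inverse_commute inverse_eq_divide scaleR_scaleR left_inverse mult_1 scaleR_one nonzero_divide_eq_eq)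
  then show ?thesis
    by (simp add: scaleR_add_right)
qed

lemma barycentric_sum:
  assumes "orient a b c \<noteq> 0"
  shows "orient b c x / orient a b c + orient c a x / orient a b c + orient a b x / orient a b c = 1"
proof -
  have "orient b c x + orient c a x + orient a b x = orient a b c"
    by (simp add: orient_def algebra_simps)
  then show ?thesis using assms by (metis add_divide_distrib divide_self)
qed

lemma collinear_iff_orient: "collinear {a, b, c} \<longleftrightarrow> orient a b c = 0"
proof
  assume "collinear {a, b, c}"
  then consider "a = c" | u where "b = u *\<^sub>R a + (1 - u) *\<^sub>R c"
    unfolding collinear_3_expand by blast
  then show "orient a b c = 0"
  proof cases
    case 2
    show ?thesis by (simp add: 2 orient_def algebra_simps)
  qed simp
next
  assume 0: "orient a b c = 0"
  show "collinear {a, b, c}"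
  proof (cases "a = c")
    case False
    define d where "d = (a$1 - c$1)^2 + (a$2 - c$2)^2"
    have d: "d \<noteq> 0"
      using False unfolding d_def by (auto simp: vec_eq_iff forall_2 sum_power2_eq_zero_iff)
    define u where "u = ((b$1 - c$1) * (a$1 - c$1) + (b$2 - c$2) * (a$2 - c$2)) / d"
    have e1: "((b$1 - c$1) * (a$1 - c$1) + (b$2 - c$2) * (a$2 - c$2)) * (a$1 - c$1) = d * (b$1 - c$1)"
     and e2: "((b$1 - c$1) * (a$1 - c$1) + (b$2 - c$2) * (a$2 - c$2)) * (a$2 - c$2) = d * (b$2 - c$2)"
      using 0 unfolding orient_def d_def by algebra+
    have "b$1 - c$1 = u * (a$1 - c$1)" "b$2 - c$2 = u * (a$2 - c$2)"
      using e1 e2 d unfolding u_def by (simp_all add: field_simps)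
    then have "b = u *\<^sub>R a + (1 - u) *\<^sub>R c"
      by (simp add: vec_eq_iff forall_2 algebra_simps)
    then show ?thesis unfolding collinear_3_expand by blast
  qed (simp add: collinear_3_expand)
qed

text \<open>The three orientations are the barycentric coordinates of \<open>x\<close>, up to the factor
\<open>orient a b c\<close>.\<close>

lemma mem_triangle_iff:
  assumes "orient a b c > 0"
  shows "x \<in> convex hull {a, b, c} \<longleftrightarrow> orient a b x \<ge> 0 \<and> orient b c x \<ge> 0 \<and> orient c a x \<ge> 0"
proof
  assume "x \<in> convex hull {a, b, c}"
  then obtain u v w where "u \<ge> 0" "v \<ge> 0" "w \<ge> 0" "u + v + w = 1" "x = u *\<^sub>R a + v *\<^sub>R b + w *\<^sub>R c"
    unfolding convex_hull_3 by auto
  then show "orient a b x \<ge> 0 \<and> orient b c x \<ge> 0 \<and> orient c a x \<ge> 0"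
    using assms by (simp add: orient_combination orient_cycle[of b c a] orient_cycle[of c a b])
next
  assume "orient a b x \<ge> 0 \<and> orient b c x \<ge> 0 \<and> orient c a x \<ge> 0"
  then show "x \<in> convex hull {a, b, c}"
    using assms barycentric_coordinates[of a b c x] barycentric_sum[of a b c x]
    unfolding convex_hull_3
    by (smt (verit, del_insts) divide_nonneg_pos mem_Collect_eq)
qed

lemma mem_interior_triangle_iff:
  assumes "orient a b c > 0"
  shows "x \<in> interior (convex hull {a, b, c}) \<longleftrightarrow> orient a b x > 0 \<and> orient b c x > 0 \<and> orient c a x > 0"
proof -
  have "\<not> collinear {a, b, c}" using assms by (simp add: collinear_iff_orient)
  then have int: "interior (convex hull {a, b, c}) =
      {v. \<exists>x y z. 0 < x \<and> 0 < y \<and> 0 < z \<and> x + y + z = 1 \<and> x *\<^sub>R a + y *\<^sub>R b + z *\<^sub>R c = v}"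
    by (rule interior_convex_hull_3_minimal) simp
  show ?thesis
  proof
    assume "x \<in> interior (convex hull {a, b, c})"
    then obtain u v w where "u > 0" "v > 0" "w > 0" "u + v + w = 1" "x = u *\<^sub>R a + v *\<^sub>R b + w *\<^sub>R c"
      unfolding int by auto
    then show "orient a b x > 0 \<and> orient b c x > 0 \<and> orient c a x > 0"
      using assms by (simp add: orient_combination orient_cycle[of b c a] orient_cycle[of c a b])
  next
    assume "orient a b x > 0 \<and> orient b c x > 0 \<and> orient c a x > 0"
    then have "orient b c x / orient a b c > 0" "orient c a x / orient a b c > 0" "orient a b x / orient a b c > 0"
      using assms by auto
    with assms barycentric_coordinates[of a b c x] barycentric_sum[of a b c x]
    show "x \<in> interior (convex hull {a, b, c})" unfolding int mem_Collect_eq by (metis less_irrefl)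
  qed
qed

lemma triangle_interior_nonempty:
  assumes "orient a b c \<noteq> 0"
  shows "interior (convex hull {a, b, c}) \<noteq> {}"
proof -
  have "\<not> collinear {a, b, c}" using assms by (simp add: collinear_iff_orient)
  then have "interior (convex hull {a, b, c}) =
      {v. \<exists>x y z. 0 < x \<and> 0 < y \<and> 0 < z \<and> x + y + z = 1 \<and> x *\<^sub>R a + y *\<^sub>R b + z *\<^sub>R c = v}"
    by (rule interior_convex_hull_3_minimal) simp
  moreover have "\<exists>x y z. (0::real) < x \<and> 0 < y \<and> 0 < z \<and> x + y + z = 1"
    by (rule exI[of _ "1/3"])+ simp
  ultimately show ?thesis by blast
qed

lemma triangle_closure_interior:
  assumes "orient a b c \<noteq> 0"
  shows "closure (interior (convex hull {a, b, c})) = convex hull {a, b, c}"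
  using triangle_interior_nonempty[OF assms]
  by (simp add: convex_closure_interior finite_imp_compact_convex_hull compact_imp_closed)

lemma triangle_affine_independent:
  assumes "orient a b c \<noteq> 0"
  shows "\<not> affine_dependent {a, b, c}" "card {a, b, c} = 3"
proof -
  have "\<not> collinear {a, b, c}" using assms by (simp add: collinear_iff_orient)
  then show "\<not> affine_dependent {a, b, c}" "card {a, b, c} = 3"
    unfolding collinear_3_eq_affine_dependent by auto
qed

lemma frontier_triangle:
  fixes a :: "real^2"
  shows "frontier (convex hull {a, b, c}) = closed_segment a b \<union> closed_segment b c \<union> closed_segment c a"
  by (rule frontier_of_triangle) simp

lemma mem_open_segment_iff:
  "x \<in> open_segment a b \<longleftrightarrow> a \<noteq> b \<and> (\<exists>t>0. t < 1 \<and> x = (1 - t) *\<^sub>R a + t *\<^sub>R b)"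
  by (auto simp: in_segment)

lemma open_segmentE:
  fixes a b :: "'a::real_vector"
  assumes "x \<in> open_segment a b"
  obtains t where "0 < t" "t < 1" "x = (1 - t) *\<^sub>R a + t *\<^sub>R b" "a \<noteq> b"
  using assms by (auto simp: in_segment)

lemma mem_open_segmentI:
  fixes a b :: "'a::real_vector"
  assumes "0 < t" "t < 1" "a \<noteq> b"
  shows "(1 - t) *\<^sub>R a + t *\<^sub>R b \<in> open_segment a b"
  unfolding in_segment using assms by blast

lemma mem_closed_segmentI:
  fixes a b :: "'a::real_vector"
  assumes "0 \<le> t" "t \<le> 1"
  shows "(1 - t) *\<^sub>R a + t *\<^sub>R b \<in> closed_segment a b"
  unfolding in_segment using assms by blast

section \<open>Segments and triangles without further vertices\<close>

text \<open>An edge or diagonal segment, without reference to the polygon.\<close>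

definition clean_segment :: "(real^2) set \<Rightarrow> (real^2) set \<Rightarrow> bool" where
  "clean_segment V s \<longleftrightarrow> (\<exists>v\<in>V. \<exists>w\<in>V. v \<noteq> w \<and> s = closed_segment v w \<and> s \<inter> V = {v, w})"

definition clean_triangle :: "(real^2) set \<Rightarrow> (real^2) set \<Rightarrow> bool" where
  "clean_triangle V T \<longleftrightarrow>
     (\<exists>a b c. orient a b c > 0 \<and> T = convex hull {a, b, c} \<and> T \<inter> V = {a, b, c})"

lemma clean_triangleE:
  assumes "clean_triangle V T"
  obtains a b c where "orient a b c > 0" "T = convex hull {a, b, c}" "T \<inter> V = {a, b, c}"
    "a \<in> V" "b \<in> V" "c \<in> V"
  using assms unfolding clean_triangle_def by (metis IntD2 insertI1 insertI2)

lemma clean_segmentE: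
  assumes "clean_segment V s"
  obtains v w where "v \<in> V" "w \<in> V" "v \<noteq> w" "s = closed_segment v w" "s \<inter> V = {v, w}"
  using assms unfolding clean_segment_def by blast

lemma clean_segment_interior_point:
  assumes "clean_segment V s" "x \<in> s" "x \<notin> V"
  obtains v w where "v \<in> V" "w \<in> V" "v \<noteq> w" "s = closed_segment v w" "s \<inter> V = {v, w}" "x \<in> open_segment v w"
  using assms unfolding clean_segment_def open_segment_def by (metis DiffI IntD2 insertCI insertE singletonD)

text \<open>If one of two overlapping segments on a line ended strictly inside the other, its end point would
be a vertex there. Here the line is parametrised by \<open>L\<close>, with \<open>a\<close> and
\<open>b\<close> at the parameters \<open>0\<close> and \<open>1\<close>.\<close>

lemma overlapping_clean_segments_ordered:
  fixes a b :: "real^2"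
  defines "L \<equiv> \<lambda>r. (1 - r) *\<^sub>R a + r *\<^sub>R b"
  assumes ab: "a \<noteq> b" and x: "s < r" "r < t" "0 < r" "r < 1"
    and cl1: "closed_segment a b \<inter> V = {a, b}"
    and cl2: "closed_segment (L s) (L t) \<inter> V = {L s, L t}"
  shows "L s = a" "L t = b"
proof -
  have inj: "L p = L q \<longleftrightarrow> p = q" for p q
  proof -
    have "L p - L q = (p - q) *\<^sub>R (b - a)" by (simp add: L_def algebra_simps)
    then show ?thesis using ab by (metis eq_iff_diff_eq_0 scaleR_eq_0_iff)
  qed
  have L01: "L 0 = a" "L 1 = b" by (simp_all add: L_def)
  have seg: "L y \<in> closed_segment (L p) (L q)" if "p \<le> y" "y \<le> q" "p < q" for p q y
  proof -
    define m where "m = (y - p) / (q - p)"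
    have m: "0 \<le> m" "m \<le> 1" using that by (auto simp: m_def field_simps)
    have y: "y = (1 - m) * p + m * q"
      using that unfolding m_def by (simp add: divide_simps) (simp add: algebra_simps)
    have "L y = (1 - m) *\<^sub>R L p + m *\<^sub>R L q"
      unfolding y L_def by (simp add: algebra_simps)
    with m show ?thesis unfolding in_segment by blast
  qed
  have V: "a \<in> V" "b \<in> V" "L s \<in> V" "L t \<in> V" using cl1 cl2 by blast+
  have s0: "s \<le> 0"
  proof (rule ccontr)
    assume "\<not> s \<le> 0"
    then have "L s \<in> closed_segment a b" using seg[of 0 s 1] x L01 by simp
    with V cl1 have "L s = L 0 \<or> L s = L 1" unfolding L01 by blast
    with \<open>\<not> s \<le> 0\<close> x show False unfolding inj by simp
  qed
  have t1: "1 \<le> t"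
  proof (rule ccontr)
    assume "\<not> 1 \<le> t"
    then have "L t \<in> closed_segment a b" using seg[of 0 t 1] x L01 by simp
    with V cl1 have "L t = L 0 \<or> L t = L 1" unfolding L01 by blast
    with \<open>\<not> 1 \<le> t\<close> x show False unfolding inj by simp
  qed
  have "a \<in> closed_segment (L s) (L t)" using seg[of s 0 t] s0 x L01 by simp
  with V cl2 have "L 0 = L s \<or> L 0 = L t" unfolding L01 by blast
  with x show "L s = a" using L01 unfolding inj by auto
  have "b \<in> closed_segment (L s) (L t)" using seg[of s 1 t] t1 x L01 by simp
  with V cl2 have "L 1 = L s \<or> L 1 = L t" unfolding L01 by blast
  with x show "L t = b" using L01 unfolding inj by auto
qed

lemma orient_zero_on_line:
  assumes "orient a b v = 0" "a \<noteq> b"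
  obtains s where "v = (1 - s) *\<^sub>R a + s *\<^sub>R b"
proof -
  have "collinear {a, v, b}"
    using assms collinear_iff_orient[of a b v] by (simp add: insert_commute)
  then obtain u where "v = u *\<^sub>R a + (1 - u) *\<^sub>R b"
    using assms(2) unfolding collinear_3_expand by blast
  then show ?thesis using that[of "1 - u"] by simp
qed

lemma overlapping_clean_segments_eq:
  assumes x: "x \<in> open_segment a b" "x \<in> open_segment v w"
    and o: "orient a b v = 0" "orient a b w = 0"
    and cl: "closed_segment a b \<inter> V = {a, b}" "closed_segment v w \<inter> V = {v, w}"
  shows "closed_segment v w = closed_segment a b"
proof -
  have ab: "a \<noteq> b" and vw: "v \<noteq> w" using x by auto
  define L where "L = (\<lambda>r. (1 - r) *\<^sub>R a + r *\<^sub>R b)"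
  have inj: "L p = L q \<longleftrightarrow> p = q" for p q
  proof -
    have "L p - L q = (p - q) *\<^sub>R (b - a)" by (simp add: L_def algebra_simps)
    then show ?thesis using ab by (metis eq_iff_diff_eq_0 scaleR_eq_0_iff)
  qed
  obtain s t where s: "v = L s" and t: "w = L t"
    using orient_zero_on_line[OF o(1) ab] orient_zero_on_line[OF o(2) ab] unfolding L_def by metis
  obtain r where r: "0 < r" "r < 1" "x = L r"
    using x(1) unfolding mem_open_segment_iff L_def by blast
  obtain m where m: "0 < m" "m < 1" "x = (1 - m) *\<^sub>R v + m *\<^sub>R w"
    using x(2) unfolding mem_open_segment_iff by blast
  have "x = L ((1 - m) * s + m * t)" unfolding m(3) s t L_def by (simp add: algebra_simps)
  then have rm: "r = (1 - m) * s + m * t" using r(3) inj by simp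
  have r1: "r = s + m * (t - s)" "r = t + (1 - m) * (s - t)" by (simp_all add: rm algebra_simps)
  have "s \<noteq> t" using vw s t by auto
  then consider "s < t" | "t < s" by linarith
  then show ?thesis
  proof cases
    case 1
    then have "m * (t - s) > 0" "(1 - m) * (s - t) < 0" using m by (auto simp: mult_pos_neg)
    then have "s < r" "r < t" using r1 by linarith+
    then have "v = a" "w = b"
      using overlapping_clean_segments_ordered[of a b s r t V] ab r cl unfolding s t L_def by auto
    then show ?thesis by simp
  next
    case 2
    then have "m * (t - s) < 0" "(1 - m) * (s - t) > 0" using m by (auto simp: mult_pos_neg)
    then have "t < r" "r < s" using r1 by linarith+
    then have "w = a" "v = b"
      using overlapping_clean_segments_ordered[of a b t r s V] ab r cl unfolding s t L_def
      by (auto simp: closed_segment_commute insert_commute)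
    then show ?thesis by (simp add: closed_segment_commute)
  qed
qed

text \<open>Close to \<open>x\<close>, the signs of the orientations with respect to the other two sides do
not change.\<close>

lemma transversal_enters_triangle:
  assumes o: "orient a b c > 0" and x: "x \<in> open_segment a b"
    and v: "orient a b v > 0" and w: "v \<noteq> x"
  shows "open_segment x v \<inter> interior (convex hull {a, b, c}) \<noteq> {}"
proof -
  obtain r where r: "0 < r" "r < 1" "x = (1 - r) *\<^sub>R a + r *\<^sub>R b"
    using x unfolding mem_open_segment_iff by blast
  have bcx: "orient b c x > 0" "orient c a x > 0" "orient a b x = 0"
    unfolding r(3) orient_segment using r o by (simp_all add: orient_cycle[of b c a] orient_cycle[of c a b])
  have small: "\<exists>e>0. e < 1 \<and> (1 - e) * p + e * q > 0" if "p > 0" for p q :: real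
  proof -
    define e where "e = p / (2 * (p + \<bar>q\<bar>))"
    have "p + \<bar>q\<bar> > 0" using that by linarith
    then have e: "0 < e" "e \<le> 1/2" "e * (p + \<bar>q\<bar>) = p / 2" using that by (auto simp: e_def field_simps)
    have "e * (- \<bar>q\<bar>) \<le> e * q" using e(1) by (intro mult_left_mono) auto
    then have "(1 - e) * p + e * q \<ge> p - e * (p + \<bar>q\<bar>)"
      by (simp add: algebra_simps)
    then have "(1 - e) * p + e * q > 0" using e that by linarith
    with e show ?thesis by (intro exI[of _ e]) auto
  qed
  obtain e1 where e1: "0 < e1" "e1 < 1" "(1 - e1) * orient b c x + e1 * orient b c v > 0" using small bcx by blast
  obtain e2 where e2: "0 < e2" "e2 < 1" "(1 - e2) * orient c a x + e2 * orient c a v > 0" using small bcx by blast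
  have mono: "(1 - e) * p + e * q > 0" if "(1 - f) * p + f * q > 0" "0 < e" "e \<le> f" "p > 0" for e f p q :: real
  proof -
    have "f * ((1 - e) * p + e * q) = e * ((1 - f) * p + f * q) + (f - e) * p" by (simp add: algebra_simps)
    also have "\<dots> > 0"
      using mult_pos_pos[OF that(2,1)] mult_nonneg_nonneg[of "f - e" p] that by linarith
    finally show ?thesis using that by (simp add: zero_less_mult_iff)
  qed
  define e where "e = min e1 e2"
  have e: "0 < e" "e < 1" "e \<le> e1" "e \<le> e2" using e1 e2 by (auto simp: e_def)
  let ?y = "(1 - e) *\<^sub>R x + e *\<^sub>R v"
  have "orient a b ?y > 0" "orient b c ?y > 0" "orient c a ?y > 0"
    unfolding orient_segment using e v bcx mono[OF e1(3)] mono[OF e2(3)] by auto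
  then have "?y \<in> interior (convex hull {a, b, c})" using mem_interior_triangle_iff[OF o] by blast
  moreover have "?y \<in> open_segment x v" unfolding mem_open_segment_iff using e w by auto
  ultimately show ?thesis by blast
qed

text \<open>At the common point \<open>x\<close>, which is inner to both segments, \<open>s\<close> either
crosses the side, and then one half of it enters the triangle, or it runs along the side, and then the two
segments agree because neither contains a vertex in its interior.\<close>

lemma clean_segment_touching_side:
  assumes o: "orient a b c > 0" and cl: "closed_segment a b \<inter> V = {a, b}"
    and s: "clean_segment V s" "s \<inter> interior (convex hull {a, b, c}) = {}"
    and x: "x \<in> closed_segment a b" "x \<in> s" "x \<notin> V"
  shows "s = closed_segment a b"
proof -
  have xab: "x \<in> open_segment a b" using x cl by (auto simp: open_segment_def)
  obtain v w where vw: "v \<in> V" "w \<in> V" "v \<noteq> w" "s = closed_segment v w" "s \<inter> V = {v, w}" "x \<in> open_segment v w"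
    using clean_segment_interior_point[OF s(1) x(2,3)] .
  have nv: "\<not> orient a b y > 0" if "y = v \<or> y = w" for y
  proof
    assume p: "orient a b y > 0"
    have "y \<noteq> x" using that vw x by auto
    from transversal_enters_triangle[OF o xab p this]
    have "closed_segment x y \<inter> interior (convex hull {a, b, c}) \<noteq> {}"
      using segment_open_subset_closed[of x y] by blast
    moreover have "closed_segment x y \<subseteq> s"
      using that x(2) vw(4) by (metis convex_closed_segment ends_in_segment closed_segment_subset)
    ultimately show False using s(2) by blast
  qed
  obtain m where m: "0 < m" "m < 1" "x = (1 - m) *\<^sub>R v + m *\<^sub>R w"
    using vw(6) unfolding mem_open_segment_iff by blast
  obtain r where r: "x = (1 - r) *\<^sub>R a + r *\<^sub>R b"
    using xab unfolding mem_open_segment_iff by blast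
  have "orient a b x = 0" unfolding r orient_segment by simp
  then have 0: "(1 - m) * orient a b v + m * orient a b w = 0" unfolding m(3) orient_segment .
  have le: "orient a b v \<le> 0" "orient a b w \<le> 0" using nv[of v] nv[of w] by auto
  have "(1 - m) * orient a b v \<le> 0" "m * orient a b w \<le> 0" using le m by (auto simp: mult_le_0_iff)
  then have "(1 - m) * orient a b v = 0" "m * orient a b w = 0" using 0 by linarith+
  then have "orient a b v = 0" "orient a b w = 0" using m by auto
  then show ?thesis
    using overlapping_clean_segments_eq[OF xab vw(6) _ _ cl] vw by auto
qed

lemma segment_Int_side_triangle:
  assumes "orient a b c > 0" "convex hull {a, b, c} \<inter> V = {a, b, c}"
  shows "closed_segment a b \<inter> V = {a, b}"
proof -
  have "c \<notin> closed_segment a b"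
  proof
    assume "c \<in> closed_segment a b"
    then obtain r where "c = (1 - r) *\<^sub>R a + r *\<^sub>R b" unfolding in_segment by blast
    then have "orient a b c = 0" by (metis orient_degenerate(2,3) orient_segment mult_zero_right add_0)
    then show False using assms by simp
  qed
  moreover have "closed_segment a b \<subseteq> convex hull {a, b, c}"
    unfolding segment_convex_hull by (rule hull_mono) auto
  ultimately show ?thesis using assms(2) by auto
qed

lemma clean_triangle_sides:
  assumes "orient a b c > 0" "convex hull {a, b, c} \<inter> V = {a, b, c}"
  shows "clean_segment V (closed_segment a b)"
  using segment_Int_side_triangle[OF assms] assms orient_degenerate(1)[of a c]
  unfolding clean_segment_def by (metis IntD2 insertI1 insertI2 less_irrefl)

text \<open>The side met by \<open>s\<close> becomes the first side of a suitable rotation of the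
corners.\<close>

lemma clean_segment_touching_triangle:
  assumes T: "clean_triangle V T" and s: "clean_segment V s" "s \<inter> interior T = {}"
    and x: "x \<in> T" "x \<in> s" "x \<notin> V"
  obtains a b c where "orient a b c > 0" "T = convex hull {a, b, c}" "T \<inter> V = {a, b, c}"
    "s = closed_segment a b"
proof -
  obtain a b c where abc: "orient a b c > 0" "T = convex hull {a, b, c}" "T \<inter> V = {a, b, c}"
    using T by (rule clean_triangleE)
  have rot: "orient b c a > 0" "T = convex hull {b, c, a}" "T \<inter> V = {b, c, a}"
    "orient c a b > 0" "T = convex hull {c, a, b}" "T \<inter> V = {c, a, b}"
    using abc by (auto simp: orient_cycle[of b c a] orient_cycle[of c a b] insert_commute)
  have "closed T" unfolding abc(2) by (simp add: finite_imp_compact_convex_hull compact_imp_closed)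
  then have "x \<in> frontier T" using x s by (auto simp: frontier_def)
  then consider "x \<in> closed_segment a b" | "x \<in> closed_segment b c" | "x \<in> closed_segment c a"
    unfolding abc(2) frontier_triangle by blast
  then show ?thesis
  proof cases
    case 1
    then show ?thesis
      using that[OF abc] clean_segment_touching_side[OF abc(1) _ s(1) _ 1 x(2,3)]
        segment_Int_side_triangle abc s by blast
  next
    case 2
    then show ?thesis
      using that[OF rot(1-3)] clean_segment_touching_side[OF rot(1) _ s(1) _ 2 x(2,3)]
        segment_Int_side_triangle rot s by metis
  next
    case 3
    then show ?thesis
      using that[OF rot(4-6)] clean_segment_touching_side[OF rot(4) _ s(1) _ 3 x(2,3)]
        segment_Int_side_triangle rot s by metis
  qed
qed

lemma clean_triangle_edge:
  assumes T: "clean_triangle V T" and s: "s edge_of T"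
  shows "clean_segment V s"
proof -
  obtain a b c where abc: "orient a b c > 0" "T = convex hull {a, b, c}" "T \<inter> V = {a, b, c}"
    using T by (rule clean_triangleE)
  have rot: "orient b c a > 0" "convex hull {b, c, a} \<inter> V = {b, c, a}"
    "orient c a b > 0" "convex hull {c, a, b} \<inter> V = {c, a, b}"
    using abc by (auto simp: orient_cycle[of b c a] orient_cycle[of c a b] insert_commute)
  have nd: "\<not> affine_dependent {a, b, c}" using triangle_affine_independent abc by simp
  obtain C where C: "C \<subseteq> {a, b, c}" "s = convex hull C" and dim: "aff_dim s = 1"
    using s unfolding edge_of_def abc(2) face_of_convex_hull_affine_independent[OF nd] by blast
  have "\<not> affine_dependent C" using nd C(1) affine_dependent_subset by blast
  then have "card C = 2" using dim C(2) aff_dim_affine_independent[of C] by (simp add: aff_dim_convex_hull)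
  then obtain p q where pq: "C = {p, q}" "p \<noteq> q" by (auto simp: card_2_iff)
  then have "C = {a, b} \<or> C = {b, c} \<or> C = {c, a}" using C(1) by auto
  then have "s = closed_segment a b \<or> s = closed_segment b c \<or> s = closed_segment c a"
    using C(2) unfolding segment_convex_hull by auto
  then show ?thesis
    using clean_triangle_sides[of a b c V] clean_triangle_sides[of b c a V] clean_triangle_sides[of c a b V] abc rot by auto
qed

section \<open>Tilings by clean triangles are diagonal triangulations\<close>

definition tiling :: "(real^2) set \<Rightarrow> (real^2) set \<Rightarrow> (real^2) set set \<Rightarrow> bool" where
  "tiling V Q \<T> \<longleftrightarrow> finite \<T> \<and> (\<forall>T\<in>\<T>. clean_triangle V T) \<and>
     (\<forall>T\<in>\<T>. \<forall>T'\<in>\<T>. T \<noteq> T' \<longrightarrow> interior T \<inter> interior T' = {}) \<and> \<Union>\<T> = Q"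

lemma clean_triangle_closure_interior:
  assumes "clean_triangle V T"
  shows "closure (interior T) = T"
  using assms triangle_closure_interior unfolding clean_triangle_def by (metis less_irrefl)

lemma open_disjoint_clean_triangle:
  assumes "clean_triangle V T" "open U" "U \<inter> interior T = {}"
  shows "U \<inter> T = {}"
  using assms open_Int_closure_eq_empty[of U "interior T"] clean_triangle_closure_interior[of V T] by auto

text \<open>A common point is either a vertex, or it is inner to a side of each triangle. In the second case
these sides coincide by \<open>clean_segment_touching_triangle\<close>. Hence the intersection is spanned by
the common vertices.\<close>

lemma clean_triangles_face_to_face:
  assumes T: "clean_triangle V T" "clean_triangle V T'" and dis: "interior T \<inter> interior T' = {}"
  shows "T \<inter> T' face_of T"
proof -
  obtain a b c where abc: "orient a b c > 0" "T = convex hull {a, b, c}" "T \<inter> V = {a, b, c}"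
    using T(1) by (rule clean_triangleE)
  obtain a' b' c' where abc': "orient a' b' c' > 0" "T' = convex hull {a', b', c'}" "T' \<inter> V = {a', b', c'}"
    using T(2) by (rule clean_triangleE)
  have cv: "convex T" "convex T'" using abc(2) abc'(2) by auto
  have dTT: "T \<inter> interior T' = {}" "T' \<inter> interior T = {}"
    using open_disjoint_clean_triangle[OF T(1), of "interior T'"]
      open_disjoint_clean_triangle[OF T(2), of "interior T"] dis by (auto simp: Int_commute)
  have "T \<inter> T' \<subseteq> convex hull (T \<inter> T' \<inter> V)"
  proof
    fix x assume x: "x \<in> T \<inter> T'"
    show "x \<in> convex hull (T \<inter> T' \<inter> V)"
    proof (cases "x \<in> V")
      case True then show ?thesis using x by (simp add: hull_inc)
    next
      case False
      have "x \<in> frontier T'" using x dTT closure_subset[of T'] by (auto simp: frontier_def)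
      then obtain s where s: "x \<in> s" "s \<subseteq> T'" "clean_segment V s"
      proof -
        have rot: "orient b' c' a' > 0" "convex hull {b', c', a'} \<inter> V = {b', c', a'}"
          "orient c' a' b' > 0" "convex hull {c', a', b'} \<inter> V = {c', a', b'}"
          using abc' by (auto simp: orient_cycle[of b' c' a'] orient_cycle[of c' a' b'] insert_commute)
        have "closed_segment a' b' \<subseteq> T'" "closed_segment b' c' \<subseteq> T'" "closed_segment c' a' \<subseteq> T'"
          unfolding abc'(2) segment_convex_hull by (rule hull_mono; auto)+
        moreover have "clean_segment V (closed_segment a' b')" "clean_segment V (closed_segment b' c')"
          "clean_segment V (closed_segment c' a')"
          using clean_triangle_sides[of a' b' c' V] clean_triangle_sides[of b' c' a' V]
            clean_triangle_sides[of c' a' b' V] abc' rot by auto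
        moreover assume "x \<in> frontier T'"
        ultimately show ?thesis using that unfolding abc'(2) frontier_triangle by blast
      qed
      have sT: "s \<inter> interior T = {}" using s(2) dTT by blast
      obtain p q r where p: "orient p q r > 0" "T = convex hull {p, q, r}" "T \<inter> V = {p, q, r}" "s = closed_segment p q"
        using clean_segment_touching_triangle[OF T(1) s(3) sT _ s(1) False] x by blast
      have "{p, q} \<subseteq> T \<inter> T' \<inter> V" using p s(2) by auto
      then have "convex hull {p, q} \<subseteq> convex hull (T \<inter> T' \<inter> V)" by (rule hull_mono)
      then show ?thesis using s(1) p(4) by (auto simp: segment_convex_hull)
    qed
  qed
  moreover have "convex hull (T \<inter> T' \<inter> V) \<subseteq> T \<inter> T'"
    using cv by (intro hull_minimal convex_Int) auto
  ultimately have eq: "T \<inter> T' = convex hull (T \<inter> T' \<inter> V)" by (rule equalityI)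
  have "\<not> affine_dependent {a, b, c}" using triangle_affine_independent abc by simp
  moreover have "T \<inter> T' \<inter> V \<subseteq> {a, b, c}" using abc(3) by blast
  ultimately show ?thesis
    unfolding abc(2) using face_of_convex_hull_affine_independent eq abc(2) by metis
qed

lemma tiling_triangulation:
  assumes "tiling V Q \<T>"
  shows "triangulation \<T>" "\<forall>T\<in>\<T>. 2 simplex T"
proof -
  have "2 simplex T" if "T \<in> \<T>" for T
  proof -
    have "clean_triangle V T" using assms that unfolding tiling_def by simp
    then obtain a b c where abc: "orient a b c > 0" "T = convex hull {a, b, c}"
      by (rule clean_triangleE)
    then show ?thesis
      using triangle_affine_independent[of a b c] unfolding simplex_def by auto
  qed
  then show s: "\<forall>T\<in>\<T>. 2 simplex T" by blast
  have faces: "T \<inter> T' face_of T" if "T \<in> \<T>" "T' \<in> \<T>" for T T'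
  proof (cases "T = T'")
    case True
    then show ?thesis
      using s that convex_simplex by (auto intro: face_of_refl)
  next
    case False
    then have "clean_triangle V T" "clean_triangle V T'" "interior T \<inter> interior T' = {}"
      using assms that unfolding tiling_def by auto
    then show ?thesis by (rule clean_triangles_face_to_face)
  qed
  have "finite \<T>" using assms unfolding tiling_def by simp
  moreover have "\<forall>T\<in>\<T>. \<exists>k. k simplex T" using s by fast
  ultimately show "triangulation \<T>" unfolding triangulation_def using faces by simp
qed

lemma tiling_diagonal_triangulation:
  assumes "tiling (segment_endpoints E) Q \<T>"
  shows "diagonal_triangulation Q E \<T>"
proof -
  have "s \<in> E \<or> diagonal_segment Q E s" if "T \<in> \<T>" "s edge_of T" for T s
  proof -
    have "clean_segment (segment_endpoints E) s" "T \<subseteq> Q"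
      using assms that clean_triangle_edge unfolding tiling_def by auto
    then show ?thesis
      using edge_of_imp_subset[OF that(2)] unfolding clean_segment_def diagonal_segment_def by blast
  qed
  then show ?thesis
    using tiling_triangulation[OF assms] assms unfolding diagonal_triangulation_def tiling_def by blast
qed

section \<open>A free triangle around a generic point\<close>

text \<open>Along a segment, two affine functions that are positive at the start and not both nonnegative at
the end: at the first zero of either one, the other is still nonnegative.\<close>

lemma first_exit:
  fixes f0 f1 g0 g1 :: real
  assumes "f0 > 0" "g0 > 0" "f1 < 0 \<or> g1 < 0"
  obtains t where "0 < t" "t < 1"
    "(1 - t) * f0 + t * f1 = 0 \<and> (1 - t) * g0 + t * g1 \<ge> 0 \<or>
     (1 - t) * g0 + t * g1 = 0 \<and> (1 - t) * f0 + t * f1 \<ge> 0"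
proof -
  have zero: "\<exists>t. 0 < t \<and> t < 1 \<and> (1 - t) * x0 + t * x1 = 0 \<and> (\<forall>s. 0 \<le> s \<and> s \<le> t \<longrightarrow> (1 - s) * x0 + s * x1 \<ge> 0)"
    if "x0 > 0" "x1 < 0" for x0 x1 :: real
  proof -
    define t where "t = x0 / (x0 - x1)"
    have t: "0 < t" "t < 1" "t * (x0 - x1) = x0" using that by (auto simp: t_def field_simps)
    have eq: "(1 - s) * x0 + s * x1 = (t - s) * (x0 - x1)" for s
      using t(3) by (simp add: algebra_simps)
    show ?thesis
      by (rule exI[of _ t]) (use t that in \<open>auto simp: eq\<close>)
  qed
  have nonneg: "(1 - t) * x0 + t * x1 \<ge> 0" if "x0 > 0" "x1 \<ge> 0" "0 < t" "t < 1" for x0 x1 t :: real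
    using that by simp
  show ?thesis
  proof (cases "f1 < 0")
    case f: True
    obtain t where t: "0 < t" "t < 1" "(1 - t) * f0 + t * f1 = 0"
      "\<forall>s. 0 \<le> s \<and> s \<le> t \<longrightarrow> (1 - s) * f0 + s * f1 \<ge> 0"
      using zero[OF assms(1) f] by blast
    show ?thesis
    proof (cases "g1 < 0")
      case g: True
      obtain u where u: "0 < u" "u < 1" "(1 - u) * g0 + u * g1 = 0"
        "\<forall>s. 0 \<le> s \<and> s \<le> u \<longrightarrow> (1 - s) * g0 + s * g1 \<ge> 0"
        using zero[OF assms(2) g] by blast
      show ?thesis
      proof (cases "t \<le> u")
        case True then show ?thesis using that[of t] t u by simp
      next
        case False then show ?thesis using that[of u] t u by simp
      qed
    next
      case False
      then show ?thesis using that[of t] t nonneg[OF assms(2), of g1 t] by simp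
    qed
  next
    case False
    then have g: "g1 < 0" using assms by simp
    obtain u where u: "0 < u" "u < 1" "(1 - u) * g0 + u * g1 = 0" using zero[OF assms(2) g] by blast
    then show ?thesis using that[of u] nonneg[OF assms(1), of f1 u] False by simp
  qed
qed

lemma finite_argmax:
  fixes k :: "'a \<Rightarrow> real"
  assumes "finite U" "U \<noteq> {}"
  obtains e where "e \<in> U" "\<And>v. v \<in> U \<Longrightarrow> k v \<le> k e"
proof -
  have "Max (k ` U) \<in> k ` U" using assms by (intro Max_in) auto
  then obtain e where "e \<in> U" "k e = Max (k ` U)" by auto
  then show ?thesis using that assms by (metis Max_ge finite_imageI imageI)
qed

text \<open>The segments in \<open>G\<close> are obstacles to the view from \<open>p\<close>. Genericity of
\<open>p\<close> keeps it off the obstacles and ensures that distinct vertices are seen in distinct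
directions.\<close>

locale viewpoint =
  fixes V :: "(real^2) set" and G :: "(real^2) set set" and p :: "real^2"
  assumes finite_V: "finite V" and finite_G: "finite G"
    and clean: "s \<in> G \<Longrightarrow> clean_segment V s"
    and noncrossing: "s \<in> G \<Longrightarrow> s' \<in> G \<Longrightarrow> s \<noteq> s' \<Longrightarrow> s \<inter> s' \<subseteq> V"
    and V_subset: "V \<subseteq> \<Union>G"
    and generic: "v \<in> V \<Longrightarrow> w \<in> V \<Longrightarrow> v \<noteq> w \<Longrightarrow> orient p v w \<noteq> 0"
begin

definition visible :: "real^2 \<Rightarrow> bool" where
  "visible v \<longleftrightarrow> v \<in> V \<and> open_segment p v \<inter> \<Union>G = {}"

lemma viewpoint_not_on_segments: "p \<notin> \<Union>G"
proof
  assume "p \<in> \<Union>G"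
  then obtain s where "s \<in> G" "p \<in> s" by blast
  then obtain v w where vw: "v \<in> V" "w \<in> V" "v \<noteq> w" "p \<in> closed_segment v w"
    using clean clean_segmentE by metis
  then obtain t where "p = (1 - t) *\<^sub>R v + t *\<^sub>R w" unfolding in_segment by blast
  then have "orient v w p = 0" using orient_segment[of v w t v w] by simp
  then show False using generic[OF vw(1-3)] by (simp add: orient_cycle[of v w p])
qed

lemma viewpoint_not_vertex: "p \<notin> V"
  using viewpoint_not_on_segments V_subset by blast

lemma closed_obstacles: "closed (\<Union>G)"
proof (rule closed_Union[OF finite_G], rule ballI)
  fix s assume "s \<in> G"
  then show "closed s" using clean clean_segmentE closed_segment by metis
qed

lemma first_hit:
  assumes "x \<in> \<Union>G"
  obtains q t where "q \<in> \<Union>G" "0 < t" "t \<le> 1" "q = (1 - t) *\<^sub>R p + t *\<^sub>R x" "open_segment p q \<inter> \<Union>G = {}"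
proof -
  have "closed (closed_segment p x \<inter> \<Union>G)" using closed_obstacles by (intro closed_Int) auto
  moreover have "closed_segment p x \<inter> \<Union>G \<noteq> {}" using assms by auto
  ultimately obtain q where q: "q \<in> closed_segment p x \<inter> \<Union>G"
    and min: "\<forall>y\<in>closed_segment p x \<inter> \<Union>G. dist p q \<le> dist p y"
    using distance_attains_inf[of "closed_segment p x \<inter> \<Union>G" p] by metis
  have "q \<in> closed_segment p x" using q by simp
  then obtain t where t: "0 \<le> t" "t \<le> 1" "q = (1 - t) *\<^sub>R p + t *\<^sub>R x" unfolding in_segment by auto
  have "t \<noteq> 0" using t(3) q viewpoint_not_on_segments by auto
  moreover have "open_segment p q \<inter> \<Union>G = {}"
  proof (rule equals0I)
    fix y assume y: "y \<in> open_segment p q \<inter> \<Union>G"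
    then have ypq: "y \<in> open_segment p q" by simp
    have "y \<in> closed_segment p x"
      using y q segment_open_subset_closed[of p q] subset_closed_segment[of p q p x] by auto
    moreover have "dist p y < dist p q"
    proof -
      obtain r where r: "0 < r" "r < 1" "y = (1 - r) *\<^sub>R p + r *\<^sub>R q" and pq: "p \<noteq> q"
        using ypq by (rule open_segmentE)
      have "p - y = r *\<^sub>R (p - q)" unfolding r(3) by (simp add: algebra_simps)
      then have "dist p y = r * dist p q" using r(1) by (simp add: dist_norm)
      then show ?thesis using r(2) pq by simp
    qed
    moreover have "y \<in> \<Union>G" using y by simp
    ultimately show False using bspec[OF min, of y] by simp
  qed
  ultimately show ?thesis using that[of q t] t q by simp
qed

text \<open>Among the vertices in the triangle \<open>p\<close>, \<open>q\<close>, \<open>w\<close>, take the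
one whose direction from \<open>p\<close> is closest to that of \<open>q\<close>. An obstacle
\<open>s'\<close> that hides it continues towards the ray through \<open>q\<close>. It cannot leave the
triangle there, because that would mean crossing the free segment from \<open>p\<close> to \<open>q\<close> or
the obstacle \<open>s\<close>, so it ends at a vertex whose direction is closer still.\<close>

lemma visible_in_sector:
  assumes s: "s \<in> G" and q: "q \<in> s" "q \<notin> V" and free: "open_segment p q \<inter> \<Union>G = {}" and w: "w \<in> s" "w \<in> V"
  obtains e where "visible e" "e \<in> convex hull {p, q, w}"
proof -
  obtain v0 m where v0: "v0 \<in> V" "v0 \<noteq> w" "s \<inter> V = {v0, w}" "s = closed_segment v0 w" "0 < m" "m < 1"
    "q = (1 - m) *\<^sub>R v0 + m *\<^sub>R w"
  proof -
    obtain a b where ab: "a \<in> V" "b \<in> V" "a \<noteq> b" "s = closed_segment a b" "s \<inter> V = {a, b}" "q \<in> open_segment a b"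
      using clean_segment_interior_point[OF clean[OF s] q] .
    have "w = a \<or> w = b" using ab w by blast
    then show ?thesis
    proof
      assume [simp]: "w = b"
      show ?thesis using ab that[of a] unfolding mem_open_segment_iff by auto
    next
      assume [simp]: "w = a"
      have "q \<in> open_segment b a" using ab(6) by (simp add: open_segment_commute)
      then show ?thesis using ab that[of b] unfolding mem_open_segment_iff
        by (auto simp: closed_segment_commute insert_commute)
    qed
  qed
  define D where "D = orient p q w"
  have D: "D \<noteq> 0"
  proof -
    have "D = orient w p q" unfolding D_def by (rule orient_cycle)
    then have "D = (1 - m) * orient w p v0" unfolding v0(7) orient_segment by simp
    also have "orient w p v0 = orient p v0 w" by (simp add: orient_def algebra_simps)
    finally show ?thesis using generic[OF v0(1) w(2) v0(2)] v0(6) by simp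
  qed
  \<comment> \<open>Barycentric coordinates for the triangle \<open>p\<close>, \<open>q\<close>, \<open>w\<close>: \<open>C\<close>, \<open>A\<close>, \<open>B\<close> belong to \<open>p\<close>, \<open>q\<close>, \<open>w\<close>.\<close>
  define A where "A = (\<lambda>x. orient p x w / D)"
  define B where "B = (\<lambda>x. orient p q x / D)"
  define C where "C = (\<lambda>x. 1 - A x - B x)"
  have lin: "A ((1 - t) *\<^sub>R x + t *\<^sub>R y) = (1 - t) * A x + t * A y"
            "B ((1 - t) *\<^sub>R x + t *\<^sub>R y) = (1 - t) * B x + t * B y" for t x y
  proof -
    have "orient p z w = orient w p z" for z by (simp add: orient_def algebra_simps)
    then show "A ((1 - t) *\<^sub>R x + t *\<^sub>R y) = (1 - t) * A x + t * A y"
              "B ((1 - t) *\<^sub>R x + t *\<^sub>R y) = (1 - t) * B x + t * B y"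
      unfolding A_def B_def by (simp_all add: orient_segment add_divide_distrib)
  qed
  have linC: "C ((1 - t) *\<^sub>R x + t *\<^sub>R y) = (1 - t) * C x + t * C y" for t x y
    unfolding C_def lin by (simp add: algebra_simps)
  have vals: "A p = 0" "B p = 0" "A q = 1" "B q = 0" "A w = 0" "B w = 1"
    using D by (simp_all add: A_def B_def D_def)
  have coord: "x = C x *\<^sub>R p + A x *\<^sub>R q + B x *\<^sub>R w" for x
  proof -
    have "orient w p x = orient p x w" by (simp add: orient_def algebra_simps)
    moreover have "C x = orient q w x / D"
      using barycentric_sum[of p q w x] D unfolding C_def A_def B_def D_def
      by (simp add: \<open>orient w p x = orient p x w\<close>)
    ultimately show ?thesis
      using barycentric_coordinates[of p q w x] D unfolding A_def B_def D_def by simp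
  qed
  have hull: "x \<in> convex hull {p, q, w}" if "A x \<ge> 0" "B x \<ge> 0" "C x \<ge> 0" for x
    unfolding convex_hull_3 using coord[of x] that by (force simp: C_def)
  have on_pq: "y = p \<or> y = q \<or> y \<in> open_segment p q" if "A y \<ge> 0" "C y \<ge> 0" "B y = 0" for y
  proof -
    have "C y = 1 - A y" using that by (simp add: C_def)
    then have "y = (1 - A y) *\<^sub>R p + A y *\<^sub>R q" using coord[of y] that by simp
    then have "y \<in> closed_segment p q" unfolding in_segment using that \<open>C y = 1 - A y\<close>
      by (intro exI[of _ "A y"] conjI) auto
    then show ?thesis by (auto simp: open_segment_def)
  qed
  have Cs: "C x = 0" if "x \<in> s" for x
  proof -
    have "C q = 0" "C w = 0" using vals by (simp_all add: C_def)
    then have "C v0 = 0" using linC[of m v0 w] v0 by simp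
    have "x \<in> closed_segment v0 w" using that v0(4) by simp
    then obtain t where "x = (1 - t) *\<^sub>R v0 + t *\<^sub>R w" unfolding in_segment by auto
    then show ?thesis using linC \<open>C w = 0\<close> \<open>C v0 = 0\<close> by simp
  qed
  define U where "U = {v\<in>V. A v \<ge> 0 \<and> B v \<ge> 0 \<and> C v \<ge> 0}"
  have "finite U" unfolding U_def using finite_V by simp
  moreover have "w \<in> U" using w vals by (simp add: U_def C_def)
  \<comment> \<open>The quotient \<open>A / B\<close> is larger for directions closer to that of \<open>q\<close>.\<close>
  ultimately obtain e where e: "e \<in> U" and max: "\<And>v. v \<in> U \<Longrightarrow> A v / B v \<le> A e / B e"
    using finite_argmax[of U "\<lambda>v. A v / B v"] by blast
  have Bpos: "B v > 0" if "v \<in> U" for v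
  proof (rule ccontr)
    assume "\<not> B v > 0"
    then have "B v = 0" "A v \<ge> 0" "C v \<ge> 0" "v \<in> V" using that by (auto simp: U_def)
    then show False using on_pq[of v] viewpoint_not_vertex q(2) free V_subset by blast
  qed
  have eV: "e \<in> V" "A e \<ge> 0" "B e > 0" "C e \<ge> 0" using e Bpos by (auto simp: U_def)
  have "open_segment p e \<inter> \<Union>G = {}"
  proof (rule equals0I)
    fix r assume r: "r \<in> open_segment p e \<inter> \<Union>G"
    then obtain s' where s': "s' \<in> G" "r \<in> s'" by auto
    have "r \<in> open_segment p e" using r by simp
    then obtain t where t: "0 < t" "t < 1" "r = (1 - t) *\<^sub>R p + t *\<^sub>R e" and pe: "p \<noteq> e"
      by (rule open_segmentE)
    define k where "k = (\<lambda>x. orient p e x / D)"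
    have kr: "k r = 0" unfolding k_def t(3) orient_segment by simp
    have k: "k x = A e * B x - B e * A x" for x
    proof -
      have "orient p e x * orient p q w = orient p e w * orient p q x - orient p q e * orient p x w"
        by (simp add: orient_def algebra_simps)
      then show ?thesis using D unfolding k_def A_def B_def D_def
        by (simp add: field_simps power2_eq_square)
    qed
    have klin: "k ((1 - t) *\<^sub>R x + t *\<^sub>R y) = (1 - t) * k x + t * k y" for t x y
      unfolding k lin by (simp add: algebra_simps)
    have rV: "r \<notin> V"
    proof
      assume "r \<in> V"
      moreover have "r \<noteq> e"
      proof
        assume "r = e"
        then have "(1 - t) *\<^sub>R (p - e) = 0" using t(3) by (simp add: algebra_simps)
        then show False using t pe by simp
      qed
      ultimately show False using generic[of e r] kr eV D by (simp add: k_def)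
    qed
    obtain v1 v2 where v12: "v1 \<in> V" "v2 \<in> V" "v1 \<noteq> v2" "s' = closed_segment v1 v2" "r \<in> open_segment v1 v2"
      using clean_segment_interior_point[OF clean[OF s'(1)] s'(2) rV] by metis
    obtain n where n: "0 < n" "n < 1" "r = (1 - n) *\<^sub>R v1 + n *\<^sub>R v2"
      using v12(5) by (rule open_segmentE)
    have n0: "(1 - n) * k v1 + n * k v2 = 0" using kr unfolding n(3) klin .
    have k0: "v = e" if "v \<in> V" "k v = 0" for v
      using generic[of e v] that eV D by (auto simp: k_def)
    have "\<not> (k v1 \<ge> 0 \<and> k v2 \<ge> 0)"
    proof
      assume "k v1 \<ge> 0 \<and> k v2 \<ge> 0"
      then have "(1 - n) * k v1 \<ge> 0" "n * k v2 \<ge> 0" using n by auto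
      then have "(1 - n) * k v1 = 0" "n * k v2 = 0" using n0 by linarith+
      then show False using n k0 v12 by auto
    qed
    \<comment> \<open>The end of \<open>s'\<close> on the side of \<open>q\<close> of the line through \<open>p\<close> and \<open>e\<close>.\<close>
    then obtain v where v: "v \<in> V" "k v < 0" "v = v1 \<or> v = v2" using v12 by force
    have rv: "closed_segment r v \<subseteq> s'"
      using v(3) s'(2) v12(4) by (metis convex_closed_segment ends_in_segment closed_segment_subset)
    have ss': "s \<noteq> s'"
    proof
      assume "s = s'"
      then have "C r = 0" using Cs s'(2) by simp
      moreover have "C r = (1 - t) + t * C e" unfolding t(3) linC by (simp add: C_def vals)
      ultimately show False using t eV(4) by (smt (verit) mult_nonneg_nonneg)
    qed
    have rpos: "B r > 0" "C r > 0"
    proof -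
      show "B r > 0" unfolding t(3) lin using vals t eV by simp
      have "C r = (1 - t) + t * C e" unfolding t(3) linC by (simp add: C_def vals)
      then show "C r > 0" using t eV(4) by (smt (verit) mult_nonneg_nonneg)
    qed
    have Apos: "A y > 0" if "k y < 0" "B y \<ge> 0" for y
    proof -
      have "B e * A y > A e * B y" using that(1) unfolding k by simp
      moreover have "A e * B y \<ge> 0" using that eV by simp
      ultimately have "B e * A y > 0" by linarith
      then show ?thesis using eV(3) by (simp add: zero_less_mult_iff)
    qed
    show False
    proof (cases "B v < 0 \<or> C v < 0")
      case False
      then have "v \<in> U" using Apos[OF v(2)] v(1) by (simp add: U_def)
      then have "A v / B v \<le> A e / B e" "B v > 0" using max Bpos by auto
      then have "A v * B e \<le> A e * B v" using eV(3) by (simp add: field_simps)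
      then show False using v(2) unfolding k by (simp add: mult.commute)
    next
      case True
      obtain u where u: "0 < u" "u < 1" "(1 - u) * B r + u * B v = 0 \<and> (1 - u) * C r + u * C v \<ge> 0 \<or>
           (1 - u) * C r + u * C v = 0 \<and> (1 - u) * B r + u * B v \<ge> 0"
        using first_exit[OF rpos True] by blast
      define y where "y = (1 - u) *\<^sub>R r + u *\<^sub>R v"
      have "y \<in> closed_segment r v" unfolding y_def using u(1,2) by (intro mem_closed_segmentI) auto
      then have ys: "y \<in> s'" using rv by blast
      have ky: "k y < 0" unfolding y_def klin kr using u v by (simp add: mult_pos_neg)
      have yy: "B y = 0 \<and> C y \<ge> 0 \<or> C y = 0 \<and> B y \<ge> 0" unfolding y_def lin linC using u(3) .
      then have Ay: "A y > 0" using Apos[OF ky] by auto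
      from yy show False
      proof
        assume 1: "B y = 0 \<and> C y \<ge> 0"
        then have "y = p \<or> y = q \<or> y \<in> open_segment p q" using on_pq[of y] Ay by simp
        moreover have "y \<noteq> p" using Ay vals by auto
        moreover have "y \<noteq> q" using ss' noncrossing[OF s s'(1)] ys q by blast
        ultimately show False using free ys s'(1) by blast
      next
        assume 2: "C y = 0 \<and> B y \<ge> 0"
        then have AB: "A y = 1 - B y" by (simp add: C_def)
        have "y = (1 - B y) *\<^sub>R q + B y *\<^sub>R w" using coord[of y] 2 AB by simp
        then have "y \<in> closed_segment q w" unfolding in_segment using 2 AB Ay
          by (intro exI[of _ "B y"] conjI) auto
        moreover have "closed_segment q w \<subseteq> s"
          using q(1) w(1) unfolding v0(4) by (simp add: closed_segment_subset)
        ultimately have "y \<in> s" by blast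
        then have "y \<in> {v0, w}" using ss' noncrossing[OF s s'(1)] ys v0(3) by blast
        moreover have "y \<noteq> w" using Ay vals by auto
        moreover have "y \<noteq> v0"
        proof
          assume "y = v0"
          then have "1 = (1 - m) * A y" using lin(1)[of m v0 w] v0(7) vals by simp
          moreover have "(1 - m) * A y < 1 * 1" using Ay AB 2 v0(5,6) by (intro mult_less_le_imp_less) auto
          ultimately show False by simp
        qed
        ultimately show False by blast
      qed
    qed
  qed
  then have "visible e" using eV by (simp add: visible_def)
  then show ?thesis using that hull eV by auto
qed


text \<open>Otherwise \<open>y\<close> would lie on the line of sight to \<open>a\<close> or to
\<open>b\<close>.\<close>

lemma wedge_obstacle_interior:
  assumes vis: "visible a" "visible b" and D: "orient p a b > 0"
    and y: "y \<in> \<Union>G" "orient a b y > 0" "orient p a y \<ge> 0" "orient p y b \<ge> 0"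
  shows "orient p a y > 0 \<and> orient p y b > 0"
proof -
  define A where "A = orient p y b / orient p a b"
  define B where "B = orient p a y / orient p a b"
  define C where "C = orient a b y / orient p a b"
  have oA: "orient b p y = orient p y b" by (simp add: orient_def algebra_simps)
  have sum: "A + B + C = 1"
    using barycentric_sum[of p a b y] D oA unfolding A_def B_def C_def by simp
  have coord: "y = C *\<^sub>R p + A *\<^sub>R a + B *\<^sub>R b"
    using barycentric_coordinates[of p a b y] D oA unfolding A_def B_def C_def by simp
  have pos: "A \<ge> 0" "B \<ge> 0" "C > 0" using y D by (auto simp: A_def B_def C_def)
  have ray: False if "visible v" "y = (1 - t) *\<^sub>R p + t *\<^sub>R v" "0 \<le> t" "t < 1" for v t
  proof -
    have pv: "p \<noteq> v" using that(1) viewpoint_not_vertex by (auto simp: visible_def)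
    have "t \<noteq> 0" using that y(1) viewpoint_not_on_segments by auto
    then have "y \<in> open_segment p v" unfolding that(2) using that(3,4) pv by (intro mem_open_segmentI) auto
    then show False using that(1) y(1) unfolding visible_def by blast
  qed
  have "B \<noteq> 0"
  proof
    assume "B = 0"
    then have "C = 1 - A" "A < 1" using sum pos by auto
    then show False using ray[OF vis(1), of A] coord \<open>B = 0\<close> pos by simp
  qed
  moreover have "A \<noteq> 0"
  proof
    assume "A = 0"
    then have "C = 1 - B" "B < 1" using sum pos by auto
    then show False using ray[OF vis(2), of B] coord \<open>A = 0\<close> pos by simp
  qed
  ultimately show ?thesis using y D unfolding A_def B_def by auto
qed

text \<open>An obstacle inside the triangle \<open>p\<close>, \<open>a\<close>, \<open>b\<close> that is hit
first from \<open>p\<close>, at \<open>q\<close>, has an end point \<open>w\<close> on the same side of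
\<open>ab\<close> as \<open>p\<close>. Since the obstacle cannot cross the lines of sight to \<open>a\<close>
and \<open>b\<close>, this end point lies inside the triangle, and \<open>visible_in_sector\<close> gives a
visible vertex in the triangle \<open>p\<close>, \<open>q\<close>, \<open>w\<close>.\<close>

lemma wedge_visible_vertex:
  assumes vis: "visible a" "visible b" and D: "orient p a b > 0"
    and x: "x \<in> \<Union>G" "orient a b x > 0" "orient p a x > 0" "orient p x b > 0"
  obtains e where "visible e" "orient a b e > 0" "orient p a e > 0" "orient p e b > 0"
proof -
  have gen: "orient p z b = orient b p z" for z by (simp add: orient_def algebra_simps)
  have abp: "orient a b p > 0" using D by (simp add: orient_cycle[of a b p])
  obtain q t where q: "q \<in> \<Union>G" "0 < t" "t \<le> 1" "q = (1 - t) *\<^sub>R p + t *\<^sub>R x" "open_segment p q \<inter> \<Union>G = {}"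
    using first_hit[OF x(1)] .
  have qpos: "orient a b q > 0" "orient p a q > 0" "orient b p q > 0"
  proof -
    have "(1 - t) * orient a b p \<ge> 0" "t * orient a b x > 0" using abp q x by simp_all
    then show "orient a b q > 0" unfolding q(4) orient_segment by linarith
    show "orient p a q > 0" "orient b p q > 0" unfolding q(4) orient_segment using q x by (simp_all add: gen)
  qed
  show ?thesis
  proof (cases "q \<in> V")
    case True
    then show ?thesis using that[of q] qpos q(5) by (simp add: visible_def gen)
  next
    case False
    obtain s where s: "s \<in> G" "q \<in> s" using q(1) by blast
    obtain v1 v2 where v12: "v1 \<in> V" "v2 \<in> V" "v1 \<noteq> v2" "s = closed_segment v1 v2" "q \<in> open_segment v1 v2"
      using clean_segment_interior_point[OF clean[OF s(1)] s(2) False] by metis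
    obtain n where n: "0 < n" "n < 1" "q = (1 - n) *\<^sub>R v1 + n *\<^sub>R v2"
      using v12(5) by (rule open_segmentE)
    have "\<not> (orient a b v1 \<le> 0 \<and> orient a b v2 \<le> 0)"
    proof
      assume "orient a b v1 \<le> 0 \<and> orient a b v2 \<le> 0"
      then have "(1 - n) * orient a b v1 \<le> 0" "n * orient a b v2 \<le> 0" using n by (auto simp: mult_le_0_iff)
      then show False using qpos(1) unfolding n(3) orient_segment by linarith
    qed
    then obtain w where w: "w \<in> V" "w \<in> s" "orient a b w > 0" using v12 by force
    have qw: "closed_segment q w \<subseteq> s" using s(2) w(2) v12(4) by (simp add: closed_segment_subset)
    have wge: "orient p a w \<ge> 0 \<and> orient b p w \<ge> 0"
    proof (rule ccontr)
      assume "\<not> ?thesis"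
      then have neg: "orient p a w < 0 \<or> orient b p w < 0" by auto
      obtain u where u: "0 < u" "u < 1" "(1 - u) * orient p a q + u * orient p a w = 0 \<and> (1 - u) * orient b p q + u * orient b p w \<ge> 0 \<or>
           (1 - u) * orient b p q + u * orient b p w = 0 \<and> (1 - u) * orient p a q + u * orient p a w \<ge> 0"
        using first_exit[OF qpos(2,3) neg] by blast
      define y where "y = (1 - u) *\<^sub>R q + u *\<^sub>R w"
      have "y \<in> closed_segment q w" unfolding y_def using u(1,2) by (intro mem_closed_segmentI) auto
      then have yG: "y \<in> \<Union>G" using qw s(1) by blast
      have "orient a b y > 0" unfolding y_def orient_segment using u(1,2) qpos(1) w(3)
        by (intro add_pos_pos mult_pos_pos) auto
      moreover have "orient p a y = 0 \<and> orient b p y \<ge> 0 \<or> orient b p y = 0 \<and> orient p a y \<ge> 0"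
        unfolding y_def orient_segment by (rule u(3))
      ultimately show False
        using wedge_obstacle_interior[OF vis D yG] by (auto simp: gen)
    qed
    then have wpos: "orient p a w > 0" "orient b p w > 0"
      using wedge_obstacle_interior[OF vis D, of w] w V_subset by (auto simp: gen)
    obtain e where e: "visible e" "e \<in> convex hull {p, q, w}"
      using visible_in_sector[OF s False q(5) w(2,1)] .
    obtain u v z where uvz: "u \<ge> 0" "v \<ge> 0" "z \<ge> 0" "u + v + z = 1" "e = u *\<^sub>R p + v *\<^sub>R q + z *\<^sub>R w"
      using e(2) unfolding convex_hull_3 by auto
    have vz: "v > 0 \<or> z > 0"
    proof (rule ccontr)
      assume "\<not> ?thesis"
      then have "v = 0" "z = 0" using uvz by auto
      then have "e = p" using uvz by simp
      then show False using e(1) viewpoint_not_vertex by (simp add: visible_def)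
    qed
    have comb: "u * k + v * l + z * m > 0" if "k \<ge> 0" "l > 0" "m > 0" for k l m :: real
      using vz uvz that by (smt (verit) mult_nonneg_nonneg mult_pos_pos)
    have "orient a b e > 0" "orient p a e > 0" "orient b p e > 0"
      unfolding uvz(5) orient_combination[OF uvz(4)]
      using comb[of "orient a b p" "orient a b q" "orient a b w"] comb[of 0 "orient p a q" "orient p a w"]
        comb[of 0 "orient b p q" "orient b p w"] abp qpos w(3) wpos by simp_all
    then show ?thesis using that[OF e(1)] by (simp add: gen)
  qed
qed

definition surrounding :: "real^2 \<Rightarrow> real^2 \<Rightarrow> real^2 \<Rightarrow> bool" where
  "surrounding a b c \<longleftrightarrow> visible a \<and> visible b \<and> visible c \<and>
     orient p a b > 0 \<and> orient p b c > 0 \<and> orient p c a > 0"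

lemma surrounding_rotate: "surrounding a b c \<Longrightarrow> surrounding b c a"
  by (simp add: surrounding_def)

text \<open>The point \<open>p\<close> is inner to one of the triangles \<open>e\<close>, \<open>b\<close>,
\<open>c\<close> and \<open>a\<close>, \<open>e\<close>, \<open>c\<close>, which arise from \<open>a\<close>,
\<open>b\<close>, \<open>c\<close> by moving a corner to \<open>e\<close> and both have smaller area.\<close>

lemma surrounding_shrink:
  assumes abc: "surrounding a b c" and e: "visible e" "orient a b e \<ge> 0" "orient p a e > 0" "orient p e b > 0"
  obtains a' b' c' where "surrounding a' b' c'" "orient a' b' c' < orient a b c"
proof -
  define D where "D = orient p a b"
  have D: "D > 0" using abc by (simp add: surrounding_def D_def)
  have pos: "orient p b c > 0" "orient p c a > 0" using abc by (auto simp: surrounding_def)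
  have M: "orient a b c = D + orient p b c + orient p c a" unfolding D_def by (rule orient_split)
  have De: "D = orient a b e + orient p a e + orient p e b"
    by (simp add: D_def orient_def algebra_simps)
  have area1: "D * orient e b c = orient a b e * orient p b c + orient p e b * orient a b c"
   and area2: "D * orient a e c = orient a b e * orient p c a + orient p a e * orient a b c"
    unfolding D_def orient_def by algebra+
  have "e \<noteq> c"
  proof
    assume "e = c"
    then show False using e(4) pos(1) orient_swap_right[of p c b] by simp
  qed
  then have "orient p c e \<noteq> 0"
    using generic[of c e] abc e(1) by (auto simp: surrounding_def visible_def)
  then consider "orient p c e > 0" | "orient p e c > 0"
    using orient_swap_right[of p c e] by linarith
  then show ?thesis
  proof cases
    case 1
    have "orient a b e * orient p b c \<le> orient a b e * orient a b c"
      using e(2) M pos D by (intro mult_left_mono) auto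
    moreover have "orient p a e * orient a b c > 0" using e(3) M pos D by simp
    ultimately have "D * orient e b c < D * orient a b c"
      unfolding area1 using De by (simp add: algebra_simps)
    then have "orient e b c < orient a b c" using D by simp
    moreover have "surrounding e b c" using abc e 1 by (simp add: surrounding_def)
    ultimately show ?thesis using that by blast
  next
    case 2
    have "orient a b e * orient p c a \<le> orient a b e * orient a b c"
      using e(2) M pos D by (intro mult_left_mono) auto
    moreover have "orient p e b * orient a b c > 0" using e(4) M pos D by simp
    ultimately have "D * orient a e c < D * orient a b c"
      unfolding area2 using De by (simp add: algebra_simps)
    then have "orient a e c < orient a b c" using D by simp
    moreover have "surrounding a e c" using abc e 2 by (simp add: surrounding_def)
    ultimately show ?thesis using that by blast
  qed
qed

definition tight :: "real^2 \<Rightarrow> real^2 \<Rightarrow> real^2 \<Rightarrow> bool" where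
  "tight a b c \<longleftrightarrow> surrounding a b c \<and>
     (\<forall>a' b' c'. surrounding a' b' c' \<longrightarrow> orient a b c \<le> orient a' b' c')"

lemma tight_rotate: "tight a b c \<Longrightarrow> tight b c a"
  unfolding tight_def using surrounding_rotate orient_cycle[of b c a] by auto

lemma tight_wedge_free:
  assumes abc: "tight a b c" and x: "x \<in> \<Union>G" "orient a b x > 0" "orient p a x \<ge> 0" "orient p x b \<ge> 0"
  shows False
proof -
  have s: "surrounding a b c" using abc by (simp add: tight_def)
  then have v: "visible a" "visible b" "orient p a b > 0" by (auto simp: surrounding_def)
  have "orient p a x > 0" "orient p x b > 0" using wedge_obstacle_interior[OF v x] by auto
  then obtain e where e: "visible e" "orient a b e > 0" "orient p a e > 0" "orient p e b > 0"
    using wedge_visible_vertex[OF v x(1,2)] by blast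
  obtain a' b' c' where "surrounding a' b' c'" "orient a' b' c' < orient a b c"
    using surrounding_shrink[OF s e(1) less_imp_le[OF e(2)] e(3,4)] .
  then show False using abc unfolding tight_def by (meson not_less)
qed

text \<open>An obstacle inside would lie in one of the three triangles that \<open>p\<close> spans with the
sides, and would produce a visible vertex there and thus a smaller surrounding triangle.\<close>

lemma tight_interior_free:
  assumes abc: "tight a b c"
  shows "interior (convex hull {a, b, c}) \<inter> \<Union>G = {}"
proof (rule equals0I)
  fix x assume x: "x \<in> interior (convex hull {a, b, c}) \<inter> \<Union>G"
  have pos: "orient p a b > 0" "orient p b c > 0" "orient p c a > 0"
    using abc by (auto simp: tight_def surrounding_def)
  have "orient a b c > 0" using pos orient_split[of a b c p] by linarith
  then have xx: "orient a b x > 0" "orient b c x > 0" "orient c a x > 0" "x \<in> \<Union>G"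
    using x mem_interior_triangle_iff by auto
  have sw: "orient p x z = - orient p z x" for z by (rule orient_swap_right)
  \<comment> \<open>A linear relation with positive coefficients between the values that tell on which side of the rays from \<open>p\<close> to the corners \<open>x\<close> lies: so their signs are mixed.\<close>
  have id: "orient p b c * orient p a x + orient p c a * orient p b x + orient p a b * orient p c x = 0"
    unfolding orient_def by algebra
  have "\<not> (orient p a x > 0 \<and> orient p b x > 0 \<and> orient p c x > 0)"
    using id pos by (smt (verit) mult_pos_pos)
  moreover have "\<not> (orient p a x < 0 \<and> orient p b x < 0 \<and> orient p c x < 0)"
    using id pos by (smt (verit) mult_pos_neg)
  ultimately consider "orient p a x \<ge> 0" "orient p b x \<le> 0" | "orient p b x \<ge> 0" "orient p c x \<le> 0"
    | "orient p c x \<ge> 0" "orient p a x \<le> 0" by linarith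
  then show False
  proof cases
    case 1 then show False using tight_wedge_free[OF abc xx(4,1)] by (simp add: sw)
  next
    case 2 then show False using tight_wedge_free[OF tight_rotate[OF abc] xx(4,2)] by (simp add: sw)
  next
    case 3 then show False
      using tight_wedge_free[OF tight_rotate[OF tight_rotate[OF abc]] xx(4,3)] by (simp add: sw)
  qed
qed

text \<open>A vertex on a side is visible, since the interior of the triangle is free, and so it can replace a
corner.\<close>

lemma tight_side_clean:
  assumes abc: "tight a b c" and v: "v \<in> V" "v \<in> closed_segment a b"
  shows "v = a \<or> v = b"
proof (rule ccontr)
  assume nv: "\<not> (v = a \<or> v = b)"
  have s: "surrounding a b c" using abc by (simp add: tight_def)
  then have pos: "orient p a b > 0" "orient p b c > 0" "orient p c a > 0" by (auto simp: surrounding_def)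
  have o: "orient a b c > 0" using pos orient_split[of a b c p] by linarith
  have "v \<in> open_segment a b" using v nv by (simp add: open_segment_def)
  then obtain t where t: "0 < t" "t < 1" "v = (1 - t) *\<^sub>R a + t *\<^sub>R b" by (rule open_segmentE)
  have e: "orient p a v > 0" "orient p v b > 0" "orient a b v = 0"
  proof -
    show "orient p a v > 0" "orient a b v = 0" unfolding t(3) orient_segment using t pos by simp_all
    have "orient p v b = orient b p v" by (simp add: orient_def algebra_simps)
    also have "\<dots> = (1 - t) * orient p a b" unfolding t(3) orient_segment by (simp add: orient_cycle[of p a b])
    finally show "orient p v b > 0" using t pos by simp
  qed
  have bc: "orient b c v \<ge> 0" "orient c a v \<ge> 0"
    unfolding t(3) orient_segment using t o by (simp_all add: orient_cycle[of b c a] orient_cycle[of c a b])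
  have "open_segment p v \<subseteq> interior (convex hull {a, b, c})"
  proof
    fix y assume "y \<in> open_segment p v"
    then obtain r where r: "0 < r" "r < 1" "y = (1 - r) *\<^sub>R p + r *\<^sub>R v" by (rule open_segmentE)
    have "(1 - r) * k + r * l > 0" if "k > 0" "l \<ge> 0" for k l :: real
      using r that by (smt (verit) mult_nonneg_nonneg mult_pos_pos)
    then have "orient a b y > 0" "orient b c y > 0" "orient c a y > 0"
      unfolding r(3) orient_segment using pos e(3) bc r(2)
      by (simp_all add: orient_cycle[of a b p] orient_cycle[of b c p] orient_cycle[of c a p])
    then show "y \<in> interior (convex hull {a, b, c})" using mem_interior_triangle_iff[OF o] by simp
  qed
  then have vis: "visible v" using v(1) tight_interior_free[OF abc] unfolding visible_def by blast
  have "orient a b v \<ge> 0" using e(3) by simp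
  then obtain a' b' c' where "surrounding a' b' c'" "orient a' b' c' < orient a b c"
    using surrounding_shrink[OF s vis _ e(1,2)] by blast
  then show False using abc unfolding tight_def by (meson not_less)
qed

lemma tight_clean:
  assumes abc: "tight a b c"
  shows "clean_triangle V (convex hull {a, b, c})" "p \<in> interior (convex hull {a, b, c})"
proof -
  have s: "surrounding a b c" using abc by (simp add: tight_def)
  then have pos: "orient p a b > 0" "orient p b c > 0" "orient p c a > 0"
    and V: "a \<in> V" "b \<in> V" "c \<in> V" by (auto simp: surrounding_def visible_def)
  have o: "orient a b c > 0" using pos orient_split[of a b c p] by linarith
  show "p \<in> interior (convex hull {a, b, c})"
    using mem_interior_triangle_iff[OF o] pos by (simp add: orient_cycle[of a b p] orient_cycle[of b c p] orient_cycle[of c a p])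
  have "v \<in> {a, b, c}" if "v \<in> V" "v \<in> convex hull {a, b, c}" for v
  proof -
    have "v \<notin> interior (convex hull {a, b, c})" using that V_subset tight_interior_free[OF abc] by blast
    then have "v \<in> frontier (convex hull {a, b, c})"
      using that closure_subset[of "convex hull {a, b, c}"] by (auto simp: frontier_def)
    then show ?thesis
      using tight_side_clean[OF abc that(1)] tight_side_clean[OF tight_rotate[OF abc] that(1)]
        tight_side_clean[OF tight_rotate[OF tight_rotate[OF abc]] that(1)]
      unfolding frontier_triangle by blast
  qed
  moreover have "{a, b, c} \<subseteq> convex hull {a, b, c}" by (rule hull_subset)
  ultimately have "convex hull {a, b, c} \<inter> V = {a, b, c}" using V by blast
  then show "clean_triangle V (convex hull {a, b, c})" using o unfolding clean_triangle_def by blast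
qed

text \<open>Otherwise all visible vertices lie strictly on one side of a line through \<open>p\<close>.
Looking in the opposite direction \<open>u\<close>, the first obstacle has an end point at least as far in
direction \<open>u\<close> as the point of impact, and \<open>visible_in_sector\<close> finds a visible vertex
on the wrong side of the line.\<close>

lemma viewpoint_in_visible_hull:
  assumes "bounded Q" "p \<in> interior Q" "frontier Q \<subseteq> \<Union>G"
  shows "p \<in> convex hull {v. visible v}"
proof (rule ccontr)
  assume np: "p \<notin> convex hull {v. visible v}"
  have fin: "finite {v. visible v}" by (rule finite_subset[OF _ finite_V]) (auto simp: visible_def)
  obtain u where u: "u \<noteq> 0" "\<And>v. visible v \<Longrightarrow> u \<bullet> v < u \<bullet> p"
  proof (cases "{v. visible v} = {}")
    case True
    then show ?thesis using that[of "axis 1 1"] by (auto simp: axis_eq_0_iff)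
  next
    case False
    have "closed (convex hull {v. visible v})"
      using fin by (simp add: finite_imp_compact_convex_hull compact_imp_closed)
    then obtain a b where ab: "a \<bullet> p < b" "\<forall>x\<in>convex hull {v. visible v}. b < a \<bullet> x"
      using separating_hyperplane_closed_point[OF convex_convex_hull _ np] by blast
    have lt: "a \<bullet> p < a \<bullet> v" if "visible v" for v
      using ab that hull_inc[of v "{v. visible v}" convex] by fastforce
    then have "a \<noteq> 0" using False by auto
    then show ?thesis using that[of "- a"] lt by simp
  qed
  obtain d where d: "0 < d" "p + d *\<^sub>R u \<in> frontier Q"
    using ray_to_frontier[OF assms(1,2) u(1)] by blast
  then have "p + d *\<^sub>R u \<in> \<Union>G" using assms(3) by blast
  then obtain q t where q: "q \<in> \<Union>G" "0 < t" "t \<le> 1" "q = (1 - t) *\<^sub>R p + t *\<^sub>R (p + d *\<^sub>R u)" "open_segment p q \<inter> \<Union>G = {}"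
    by (rule first_hit)
  have "q = p + (t * d) *\<^sub>R u" unfolding q(4) by (simp add: algebra_simps)
  moreover have "t * d * (u \<bullet> u) > 0" using q(2) d(1) u(1) by simp
  ultimately have uq: "u \<bullet> q > u \<bullet> p" by (simp add: inner_add_right)
  have qV: "q \<notin> V"
  proof
    assume "q \<in> V"
    then have "visible q" using q(5) by (simp add: visible_def)
    then show False using u(2)[of q] uq by simp
  qed
  obtain s where s: "s \<in> G" "q \<in> s" using q(1) by blast
  obtain v1 v2 where v12: "v1 \<in> V" "v2 \<in> V" "s = closed_segment v1 v2" "q \<in> open_segment v1 v2"
    using clean_segment_interior_point[OF clean[OF s(1)] s(2) qV] by metis
  obtain n where n: "0 < n" "n < 1" "q = (1 - n) *\<^sub>R v1 + n *\<^sub>R v2"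
    using v12(4) by (rule open_segmentE)
  have "\<not> (u \<bullet> v1 < u \<bullet> q \<and> u \<bullet> v2 < u \<bullet> q)"
  proof
    assume "u \<bullet> v1 < u \<bullet> q \<and> u \<bullet> v2 < u \<bullet> q"
    then have "(1 - n) * (u \<bullet> v1) < (1 - n) * (u \<bullet> q)" "n * (u \<bullet> v2) < n * (u \<bullet> q)" using n by auto
    moreover have "u \<bullet> q = (1 - n) * (u \<bullet> v1) + n * (u \<bullet> v2)" unfolding n(3) by (simp add: inner_add_right)
    ultimately show False by (simp add: algebra_simps)
  qed
  then obtain w where w: "w \<in> V" "w \<in> s" "u \<bullet> w \<ge> u \<bullet> q" using v12 by force
  obtain e where e: "visible e" "e \<in> convex hull {p, q, w}"
    using visible_in_sector[OF s qV q(5) w(2,1)] .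
  obtain x y z where xyz: "x \<ge> 0" "y \<ge> 0" "z \<ge> 0" "x + y + z = 1" "e = x *\<^sub>R p + y *\<^sub>R q + z *\<^sub>R w"
    using e(2) unfolding convex_hull_3 by auto
  have "y * (u \<bullet> p) \<le> y * (u \<bullet> q)" "z * (u \<bullet> p) \<le> z * (u \<bullet> w)"
    using xyz uq w(3) by (auto intro!: mult_left_mono)
  moreover have "u \<bullet> e = x * (u \<bullet> p) + y * (u \<bullet> q) + z * (u \<bullet> w)"
    unfolding xyz(5) by (simp add: inner_add_right)
  moreover have "u \<bullet> p = x * (u \<bullet> p) + y * (u \<bullet> p) + z * (u \<bullet> p)"
    using xyz(4) by (metis distrib_right mult_1)
  ultimately show False using u(2)[OF e(1)] by linarith
qed

lemma surrounding_exists: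
  assumes "p \<in> convex hull {v. visible v}"
  obtains a b c where "surrounding a b c"
proof -
  obtain S where S: "finite S" "S \<subseteq> {v. visible v}" "card S \<le> 3" "p \<in> convex hull S"
    using assms unfolding caratheodory[of "{v. visible v}"] by auto
  have noseg: "p \<notin> closed_segment v w" if "visible v" "visible w" for v w
  proof
    assume "p \<in> closed_segment v w"
    then obtain t where t: "p = (1 - t) *\<^sub>R v + t *\<^sub>R w" unfolding in_segment by blast
    have "v \<noteq> w"
    proof
      assume "v = w"
      then have "p = v" using t by (simp add: algebra_simps)
      then show False using that(1) viewpoint_not_vertex unfolding visible_def by blast
    qed
    moreover have "orient v w p = 0" using t orient_segment[of v w t v w] by simp
    ultimately show False using generic[of v w] that by (simp add: orient_cycle[of v w p] visible_def)
  qed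
  have "S \<noteq> {}" using S(4) by auto
  then have "card S = 1 \<or> card S = 2 \<or> card S = 3" using S(1,3) card_gt_0_iff[of S] by linarith
  then consider v where "S = {v}" | v w where "S = {v, w}" | a b c where "S = {a, b, c}" "a \<noteq> b" "a \<noteq> c" "b \<noteq> c"
    by (metis card_1_singletonE card_2_iff card_3_iff)
  then show ?thesis
  proof cases
    case 1 then show ?thesis using noseg[of v v] S by simp
  next
    case 2 then show ?thesis using noseg[of v w] S by (simp add: segment_convex_hull)
  next
    case (3 a b c)
    have vis: "visible a" "visible b" "visible c" using 3 S(2) by auto
    obtain u v w where uvw: "u \<ge> 0" "v \<ge> 0" "w \<ge> 0" "u + v + w = 1" "p = u *\<^sub>R a + v *\<^sub>R b + w *\<^sub>R c"
      using S(4) unfolding 3(1) convex_hull_3 by auto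
    have coeff: "orient p a b = w * orient a b c" "orient p b c = u * orient a b c" "orient p c a = v * orient a b c"
    proof -
      have "orient a b p = w * orient a b c" "orient b c p = u * orient a b c" "orient c a p = v * orient a b c"
        unfolding uvw(5) orient_combination[OF uvw(4)]
        by (simp_all add: orient_cycle[of b c a] orient_cycle[of c a b])
      then show "orient p a b = w * orient a b c" "orient p b c = u * orient a b c" "orient p c a = v * orient a b c"
        by (simp_all add: orient_cycle[of a b p] orient_cycle[of b c p] orient_cycle[of c a p])
    qed
    have "orient p a b \<noteq> 0" "orient p b c \<noteq> 0" "orient p c a \<noteq> 0"
      using generic[of a b] generic[of b c] generic[of c a] vis 3 by (auto simp: visible_def)
    then have nz: "u > 0" "v > 0" "w > 0" "orient a b c \<noteq> 0" using coeff uvw by auto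
    show ?thesis
    proof (cases "orient a b c > 0")
      case True
      then show ?thesis using that[of a b c] coeff nz vis by (simp add: surrounding_def)
    next
      case False
      then have "orient a b c < 0" using nz by simp
      then have "orient p a b < 0" "orient p b c < 0" "orient p c a < 0" using coeff nz by (auto simp: mult_pos_neg)
      then show ?thesis using that[of b a c] vis orient_swap_right[of p a b] orient_swap_right[of p b c] orient_swap_right[of p c a]
        by (simp add: surrounding_def)
    qed
  qed
qed

lemma free_clean_triangle:
  assumes "bounded Q" "p \<in> interior Q" "frontier Q \<subseteq> \<Union>G"
  obtains T where "clean_triangle V T" "p \<in> interior T" "interior T \<inter> \<Union>G = {}"
proof -
  obtain a0 b0 c0 where "surrounding a0 b0 c0"
    using surrounding_exists[OF viewpoint_in_visible_hull[OF assms]] .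
  define U where "U = {x \<in> V \<times> V \<times> V. surrounding (fst x) (fst (snd x)) (snd (snd x))}"
  have U: "finite U" "(a0, b0, c0) \<in> U"
    using finite_V \<open>surrounding a0 b0 c0\<close> by (auto simp: U_def surrounding_def visible_def)
  then obtain x where x: "x \<in> U" and
    max: "\<And>y. y \<in> U \<Longrightarrow> - orient (fst y) (fst (snd y)) (snd (snd y)) \<le> - orient (fst x) (fst (snd x)) (snd (snd x))"
    using finite_argmax[of U "\<lambda>x. - orient (fst x) (fst (snd x)) (snd (snd x))"] by blast
  obtain a b c where abc: "x = (a, b, c)" by (metis prod.collapse)
  have "tight a b c"
    unfolding tight_def
  proof (intro conjI allI impI)
    show "surrounding a b c" using x abc by (simp add: U_def)
    fix a' b' c' assume s: "surrounding a' b' c'"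
    then have "(a', b', c') \<in> U" by (simp add: U_def surrounding_def visible_def)
    then show "orient a b c \<le> orient a' b' c'" using max[of "(a', b', c')"] abc by simp
  qed
  then show ?thesis using that tight_clean tight_interior_free by blast
qed

end

section \<open>Existence of tilings\<close>

lemma negligible_line:
  assumes "v \<noteq> w"
  shows "negligible {p. orient p v w = 0}"
proof -
  define a :: "real^2" where "a = vector [v$2 - w$2, w$1 - v$1]"
  have "a \<noteq> 0" using assms by (auto simp: a_def vec_eq_iff forall_2)
  moreover have "{p. orient p v w = 0} = {p. a \<bullet> p = a \<bullet> v}"
    by (auto simp: a_def inner_vec_def sum_2 orient_def algebra_simps)
  ultimately show ?thesis using negligible_hyperplane[of a "a \<bullet> v"] by simp
qed

lemma exists_generic_point:
  assumes V: "finite V" and U: "open U" "U \<noteq> {}"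
  obtains p where "p \<in> U" "\<And>v w. v \<in> V \<Longrightarrow> w \<in> V \<Longrightarrow> v \<noteq> w \<Longrightarrow> orient p v w \<noteq> 0"
proof -
  define B where "B = (\<Union>(v, w) \<in> {(v, w). v \<in> V \<and> w \<in> V \<and> v \<noteq> w}. {p. orient p v w = 0})"
  have "finite {(v, w). v \<in> V \<and> w \<in> V \<and> v \<noteq> w}"
    by (rule finite_subset[of _ "V \<times> V"]) (use V in auto)
  then have "negligible B" unfolding B_def by (intro negligible_Union finite_imageI) (auto intro: negligible_line)
  then have "\<not> U \<subseteq> B" using open_not_negligible[OF U] negligible_subset by blast
  then obtain p where "p \<in> U" "p \<notin> B" by blast
  then show ?thesis using that[of p] by (auto simp: B_def)
qed

lemma finite_clean_segments:
  assumes "finite V"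
  shows "finite {s. clean_segment V s}"
  by (rule finite_subset[of _ "(\<lambda>(v, w). closed_segment v w) ` (V \<times> V)"])
    (use assms in \<open>auto simp: clean_segment_def\<close>)

lemma clean_triangle_hull:
  assumes "clean_triangle V T"
  shows "T = convex hull (T \<inter> V)"
  using assms unfolding clean_triangle_def by metis

lemma finite_clean_triangles:
  assumes "finite V"
  shows "finite {T. clean_triangle V T}"
proof (rule finite_subset)
  show "{T. clean_triangle V T} \<subseteq> (\<lambda>X. convex hull X) ` Pow V"
    using clean_triangle_hull by (metis (no_types, lifting) Int_lower2 PowI image_eqI mem_Collect_eq subsetI)
qed (use assms in simp)

lemma connected_subset_of_frontier_disjoint:
  assumes "connected S" "S \<inter> T \<noteq> {}" "S \<inter> frontier T = {}"
  shows "S \<subseteq> T"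
  using connected_Int_frontier[OF assms(1,2)] assms(3) by blast

lemma clean_triangle_properties:
  assumes "clean_triangle V T"
  shows "closed T" "connected (interior T)" "interior T \<noteq> {}"
proof -
  obtain a b c where abc: "orient a b c > 0" "T = convex hull {a, b, c}"
    using assms by (rule clean_triangleE)
  show "closed T" unfolding abc(2) by (simp add: finite_imp_compact_convex_hull compact_imp_closed)
  show "connected (interior T)" unfolding abc(2) by (simp add: convex_connected)
  show "interior T \<noteq> {}" unfolding abc(2) using triangle_interior_nonempty abc(1) by simp
qed

text \<open>The tiles are all clean triangles in \<open>Q\<close> whose interior is free of the maximal
non-crossing set \<open>G\<close>. By maximality \<open>G\<close> contains their sides; so the connected
interior of a tile cannot meet the boundary of another tile, and two tiles with a common inner point
coincide.\<close>

theorem tiling_exists: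
  assumes V: "finite V" and E: "finite E" "\<And>e. e \<in> E \<Longrightarrow> clean_segment V e" "V \<subseteq> \<Union>E"
    and nc: "\<And>e e'. e \<in> E \<Longrightarrow> e' \<in> E \<Longrightarrow> e \<noteq> e' \<Longrightarrow> e \<inter> e' \<subseteq> V"
    and Q: "bounded Q" "Q = closure (interior Q)" "frontier Q = \<Union>E"
  obtains \<T> where "tiling V Q \<T>"
proof -
  define \<S> where "\<S> = {s. clean_segment V s \<and> s \<subseteq> Q}"
  define \<G> where "\<G> = {G. E \<subseteq> G \<and> G \<subseteq> \<S> \<and> (\<forall>s\<in>G. \<forall>s'\<in>G. s \<noteq> s' \<longrightarrow> s \<inter> s' \<subseteq> V)}"
  have clQ: "closed Q" using Q(2) closed_closure by metis
  have "finite \<S>" using finite_clean_segments[OF V] by (simp add: \<S>_def)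
  then have "finite \<G>" by (rule_tac finite_subset[of _ "Pow \<S>"]) (auto simp: \<G>_def)
  moreover have "E \<in> \<G>"
  proof -
    have "\<Union>E \<subseteq> Q" using Q(3) frontier_subset_closed[OF clQ] by simp
    then show ?thesis using E(2) nc by (auto simp: \<G>_def \<S>_def)
  qed
  ultimately obtain G where G: "G \<in> \<G>" and max: "\<And>G'. G' \<in> \<G> \<Longrightarrow> G \<subseteq> G' \<Longrightarrow> G' = G"
    using finite_has_maximal[of \<G>] by blast
  have G': "E \<subseteq> G" "G \<subseteq> \<S>" "\<And>s s'. s \<in> G \<Longrightarrow> s' \<in> G \<Longrightarrow> s \<noteq> s' \<Longrightarrow> s \<inter> s' \<subseteq> V"
    using G by (auto simp: \<G>_def)
  have finG: "finite G" using G'(2) \<open>finite \<S>\<close> finite_subset by blast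
  have frG: "frontier Q \<subseteq> \<Union>G" using Q(3) G'(1) by auto
  define \<T> where "\<T> = {T. clean_triangle V T \<and> T \<subseteq> Q \<and> interior T \<inter> \<Union>G = {}}"
  have side: "closed_segment a b \<in> G"
    if abc: "orient a b c > 0" "convex hull {a, b, c} \<inter> V = {a, b, c}" "convex hull {a, b, c} \<subseteq> Q"
      and int: "interior (convex hull {a, b, c}) \<inter> \<Union>G = {}" for a b c
  proof -
    have cl: "clean_segment V (closed_segment a b)" using clean_triangle_sides[OF abc(1,2)] .
    have eq: "s = closed_segment a b" if s: "s \<in> G" "x \<in> s" "x \<in> closed_segment a b" "x \<notin> V" for s x
      using clean_segment_touching_side[OF abc(1) segment_Int_side_triangle[OF abc(1,2)] _ _ s(3,2,4)]
        s(1) G'(2) int by (auto simp: \<S>_def)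
    have "closed_segment a b \<subseteq> convex hull {a, b, c}"
      unfolding segment_convex_hull by (rule hull_mono) auto
    then have "closed_segment a b \<in> \<S>" using cl abc(3) by (auto simp: \<S>_def)
    moreover have "s \<inter> s' \<subseteq> V" if "s \<in> insert (closed_segment a b) G" "s' \<in> insert (closed_segment a b) G" "s \<noteq> s'" for s s'
      using that G'(3)[of s s'] eq[of s] eq[of s'] by blast
    ultimately have "insert (closed_segment a b) G \<in> \<G>"
      using G'(1,2) unfolding \<G>_def by (simp add: subset_insertI2)
    then show ?thesis using max by blast
  qed
  have frT: "frontier T \<subseteq> \<Union>G" if T: "T \<in> \<T>" for T
  proof -
    have T': "clean_triangle V T" "T \<subseteq> Q" "interior T \<inter> \<Union>G = {}" using T by (auto simp: \<T>_def)
    obtain a b c where abc: "orient a b c > 0" "T = convex hull {a, b, c}" "T \<inter> V = {a, b, c}"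
      using T'(1) by (rule clean_triangleE)
    have eqs: "{b, c, a} = {a, b, c}" "{c, a, b} = {a, b, c}" by auto
    have "closed_segment a b \<in> G" "closed_segment b c \<in> G" "closed_segment c a \<in> G"
      using side[of a b c] side[of b c a] side[of c a b] abc T'
      by (simp_all add: eqs orient_cycle[of b c a] orient_cycle[of c a b])
    then show ?thesis unfolding abc(2) frontier_triangle by blast
  qed
  have sub: "T' \<subseteq> T" if T: "T \<in> \<T>" "T' \<in> \<T>" and meet: "interior T \<inter> interior T' \<noteq> {}" for T T'
  proof -
    have c: "clean_triangle V T" "clean_triangle V T'" "interior T' \<inter> \<Union>G = {}" using T by (auto simp: \<T>_def)
    have "interior T' \<inter> T \<noteq> {}" using meet interior_subset[of T] by blast
    moreover have "interior T' \<inter> frontier T = {}" using c(3) frT[OF T(1)] by blast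
    ultimately have "interior T' \<subseteq> T"
      using connected_subset_of_frontier_disjoint clean_triangle_properties(2)[OF c(2)] by blast
    then have "closure (interior T') \<subseteq> T"
      using clean_triangle_properties(1)[OF c(1)] by (rule closure_minimal)
    then show ?thesis using clean_triangle_closure_interior[OF c(2)] by simp
  qed
  have finT: "finite \<T>" using finite_clean_triangles[OF V] by (rule finite_subset[rotated]) (auto simp: \<T>_def)
  have "interior Q \<subseteq> \<Union>\<T>"
  proof (rule ccontr)
    assume "\<not> interior Q \<subseteq> \<Union>\<T>"
    then have ne: "interior Q - \<Union>\<T> \<noteq> {}" by blast
    have "closed (\<Union>\<T>)" using finT clean_triangle_properties(1) by (intro closed_Union) (auto simp: \<T>_def)
    then have "open (interior Q - \<Union>\<T>)" by (intro open_Diff) auto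
    then obtain p where p: "p \<in> interior Q - \<Union>\<T>"
      and gen: "\<And>v w. v \<in> V \<Longrightarrow> w \<in> V \<Longrightarrow> v \<noteq> w \<Longrightarrow> orient p v w \<noteq> 0"
      using exists_generic_point[OF V _ ne] by blast
    interpret viewpoint V G p
    proof
      show "clean_segment V s" if "s \<in> G" for s using that G'(2) by (auto simp: \<S>_def)
      show "V \<subseteq> \<Union>G" using E(3) G'(1) by blast
    qed (use V finG G'(3) gen in auto)
    have pQ: "p \<in> interior Q" using p by simp
    obtain T where T: "clean_triangle V T" "p \<in> interior T" "interior T \<inter> \<Union>G = {}"
      using free_clean_triangle[OF Q(1) pQ frG] .
    have "interior T \<inter> Q \<noteq> {}" using T(2) pQ interior_subset[of Q] by blast
    moreover have "interior T \<inter> frontier Q = {}" using T(3) frG by blast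
    ultimately have "interior T \<subseteq> Q"
      using connected_subset_of_frontier_disjoint clean_triangle_properties(2)[OF T(1)] by blast
    then have "T \<subseteq> Q" using closure_minimal[OF _ clQ] clean_triangle_closure_interior[OF T(1)] by metis
    then have "T \<in> \<T>" using T by (simp add: \<T>_def)
    then show False using p T(2) interior_subset[of T] by blast
  qed
  moreover have clT: "closed (\<Union>\<T>)" using finT clean_triangle_properties(1) by (intro closed_Union) (auto simp: \<T>_def)
  ultimately have "closure (interior Q) \<subseteq> \<Union>\<T>" by (intro closure_minimal)
  then have "\<Union>\<T> = Q" using Q(2) by (auto simp: \<T>_def)
  moreover have "interior T \<inter> interior T' = {}" if "T \<in> \<T>" "T' \<in> \<T>" "T \<noteq> T'" for T T'
    using sub[of T T'] sub[of T' T] that by (metis Int_commute subset_antisym)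
  moreover have "clean_triangle V T" if "T \<in> \<T>" for T using that by (simp add: \<T>_def)
  ultimately have "tiling V Q \<T>" using finT unfolding tiling_def by simp
  then show ?thesis using that by blast
qed

section \<open>Flips and locally Delaunay tilings\<close>

text \<open>The factor three between the integral of the linear interpolation of \<open>v \<bullet> v\<close>
and this expression is left out. Clean triangles have their corners as their only points in \<open>V\<close>,
so the sum ranges over the corners.\<close>

definition weight :: "(real^2) set \<Rightarrow> (real^2) set \<Rightarrow> real" where
  "weight V T = measure lborel T * (\<Sum>v\<in>T \<inter> V. v \<bullet> v)"

lemma measure_triangle_orient: "measure lborel (convex hull {a, b, c}) = \<bar>orient a b c\<bar> / 2"
  unfolding content_triangle orient_def by (simp add: abs_minus_commute mult.commute)

lemma weight_triangle:
  assumes "orient a b c > 0" "T = convex hull {a, b, c}" "T \<inter> V = {a, b, c}"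
  shows "weight V T = orient a b c * (a \<bullet> a + b \<bullet> b + c \<bullet> c) / 2"
proof -
  have "a \<noteq> b" "b \<noteq> c" "a \<noteq> c" using assms(1) by auto
  then have "(\<Sum>v\<in>T \<inter> V. v \<bullet> v) = a \<bullet> a + b \<bullet> b + c \<bullet> c" unfolding assms(3) by simp
  moreover have "measure lborel T = orient a b c / 2" using assms(1,2) measure_triangle_orient by simp
  ultimately show ?thesis by (simp add: weight_def)
qed

lemma weight_nonneg: "weight V T \<ge> 0"
  unfolding weight_def by (intro mult_nonneg_nonneg sum_nonneg) auto

text \<open>For counterclockwise triangles \<open>a b c\<close> and \<open>a c d\<close> with angles
\<open>\<beta>\<close> at \<open>b\<close> and \<open>\<delta>\<close> at \<open>d\<close>, this is a positive
multiple of \<open>sin (\<beta> + \<delta>)\<close>; it is the in-circle determinant up to sign.\<close>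

definition flip_defect :: "real^2 \<Rightarrow> real^2 \<Rightarrow> real^2 \<Rightarrow> real^2 \<Rightarrow> real" where
  "flip_defect a b c d = orient a b c * ((a - d) \<bullet> (c - d)) + orient a c d * ((a - b) \<bullet> (c - b))"

text \<open>Both sides are, up to the same factor, the signed volume of the tetrahedron spanned by the four
points of the paraboloid above the corners.\<close>

lemma flip_weight:
  "orient a b c * (a \<bullet> a + b \<bullet> b + c \<bullet> c) + orient a c d * (a \<bullet> a + c \<bullet> c + d \<bullet> d)
   - orient a b d * (a \<bullet> a + b \<bullet> b + d \<bullet> d) - orient b c d * (b \<bullet> b + c \<bullet> c + d \<bullet> d)
   = - flip_defect a b c d"
  unfolding flip_defect_def orient_def inner_vec_def sum_2
  by (simp add: algebra_simps)

text \<open>If the angles at \<open>b\<close> and \<open>d\<close> add up to more than \<open>\<pi>\<close>,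
then those of the quadrilateral at \<open>a\<close> and \<open>c\<close> are smaller than
\<open>\<pi>\<close>.\<close>

lemma flip_convex:
  assumes "orient a b c > 0" "orient a c d > 0" "flip_defect a b c d < 0"
  shows "orient a b d > 0" "orient b c d > 0"
proof -
  \<comment> \<open>With \<open>a\<close> and \<open>c\<close> on a coordinate axis these identities can be read off.\<close>
  have 1: "orient a b c * ((d - a) \<bullet> (d - a)) + orient a c d * ((b - a) \<bullet> (b - a))
     - ((c - a) \<bullet> (c - a)) * orient a b d = flip_defect a b c d"
    and 2: "orient a b c * ((d - c) \<bullet> (d - c)) + orient a c d * ((b - c) \<bullet> (b - c))
     - ((c - a) \<bullet> (c - a)) * orient b c d = flip_defect a b c d"
    unfolding flip_defect_def orient_def inner_vec_def sum_2 by (simp_all add: algebra_simps)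
  have "orient a b c * ((d - a) \<bullet> (d - a)) \<ge> 0" "orient a c d * ((b - a) \<bullet> (b - a)) \<ge> 0"
    "orient a b c * ((d - c) \<bullet> (d - c)) \<ge> 0" "orient a c d * ((b - c) \<bullet> (b - c)) \<ge> 0"
    using assms(1,2) by simp_all
  then have "((c - a) \<bullet> (c - a)) * orient a b d > 0" "((c - a) \<bullet> (c - a)) * orient b c d > 0"
    using 1 2 assms(3) by linarith+
  moreover have "(c - a) \<bullet> (c - a) \<ge> 0" by simp
  ultimately show "orient a b d > 0" "orient b c d > 0" by (auto simp: zero_less_mult_iff)
qed

text \<open>Cyclic relabelling of the corners turns this into all four inclusions between the two dissections
of a convex quadrilateral by its diagonals.\<close>

lemma quadrilateral_diagonal_cover:
  assumes o: "orient a b c > 0" "orient a c d > 0" "orient a b d > 0" "orient b c d > 0"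
  shows "convex hull {a, b, d} \<subseteq> convex hull {a, b, c} \<union> convex hull {a, c, d}"
proof
  fix x assume "x \<in> convex hull {a, b, d}"
  then obtain u v w where uvw: "u \<ge> 0" "v \<ge> 0" "w \<ge> 0" "u + v + w = 1" "x = u *\<^sub>R a + v *\<^sub>R b + w *\<^sub>R d"
    unfolding convex_hull_3 by auto
  have x: "orient a b x \<ge> 0" "orient d a x \<ge> 0" "orient b c x \<ge> 0" "orient c d x \<ge> 0"
    unfolding uvw(5) orient_combination[OF uvw(4)] using uvw(1-3) o
    by (simp_all add: orient_cycle[of d a b] orient_cycle[of b d a] orient_cycle[of b c a] orient_cycle[of c d a] orient_cycle[of c d b])
  have "orient c a x = - orient a c x" by (rule orient_swap)
  then show "x \<in> convex hull {a, b, c} \<union> convex hull {a, c, d}"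
    using x mem_triangle_iff[OF o(1)] mem_triangle_iff[OF o(2)] by (cases "orient a c x \<ge> 0") auto
qed

lemma flip_tiling:
  assumes til: "tiling V Q \<T>"
    and T: "convex hull {a, b, c} \<in> \<T>" "orient a b c > 0" "convex hull {a, b, c} \<inter> V = {a, b, c}"
    and T': "convex hull {a, c, d} \<in> \<T>" "orient a c d > 0" "convex hull {a, c, d} \<inter> V = {a, c, d}"
    and bad: "flip_defect a b c d < 0"
  obtains \<T>' where "tiling V Q \<T>'" "(\<Sum>T\<in>\<T>'. weight V T) < (\<Sum>T\<in>\<T>. weight V T)"
proof -
  note o = T(2) T'(2) flip_convex[OF T(2) T'(2) bad]
  let ?T = "convex hull {a, b, c}" and ?T' = "convex hull {a, c, d}"
  let ?R = "convex hull {a, b, d}" and ?R' = "convex hull {b, c, d}"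
  define \<R> where "\<R> = \<T> - {?T, ?T'}"
  have fin: "finite \<T>" and cl: "\<And>S. S \<in> \<T> \<Longrightarrow> clean_triangle V S" and un: "\<Union>\<T> = Q"
    and dis: "\<And>S S'. S \<in> \<T> \<Longrightarrow> S' \<in> \<T> \<Longrightarrow> S \<noteq> S' \<Longrightarrow> interior S \<inter> interior S' = {}"
    using til unfolding tiling_def by auto
  have perm: "{b, c, a} = {a, b, c}" "{b, d, a} = {a, b, d}" "{c, d, b} = {b, c, d}" "{c, d, a} = {a, c, d}"
    "{c, a, b} = {a, b, c}" "{d, a, c} = {a, c, d}" "{d, a, b} = {a, b, d}" "{d, b, c} = {b, c, d}"
    by auto
  have cyc: "orient b d a > 0" "orient b c a > 0" "orient c d a > 0" "orient c d b > 0" "orient c a b > 0"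
     "orient d a b > 0" "orient d b c > 0" "orient d a c > 0"
    using o by (simp_all add: orient_cycle[of b d a] orient_cycle[of b c a] orient_cycle[of c d a] orient_cycle[of c d b]
      orient_cycle[of c a b] orient_cycle[of d a b] orient_cycle[of d b c] orient_cycle[of d a c])
  have c1: "?R \<subseteq> ?T \<union> ?T'" using quadrilateral_diagonal_cover[OF o] .
  have c2: "?T \<subseteq> ?R' \<union> ?R"
    using quadrilateral_diagonal_cover[of b c d a] o cyc unfolding perm by blast
  have c3: "?R' \<subseteq> ?T' \<union> ?T"
    using quadrilateral_diagonal_cover[of c d a b] o cyc unfolding perm by blast
  have c4: "?T' \<subseteq> ?R \<union> ?R'"
    using quadrilateral_diagonal_cover[of d a b c] o cyc unfolding perm by blast
  have V: "a \<in> V" "b \<in> V" "c \<in> V" "d \<in> V" using T(3) T'(3) by blast+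
  have TV: "(?T \<union> ?T') \<inter> V = {a, b, c, d}"
    unfolding Int_Un_distrib2 T(3) T'(3) by auto
  have "c \<notin> ?R"
    using mem_triangle_iff[OF o(3), of c] o(4) orient_swap_right[of b c d] by auto
  have RV: "?R \<inter> V = {a, b, d}"
  proof
    show "?R \<inter> V \<subseteq> {a, b, d}"
    proof
      fix x assume x: "x \<in> ?R \<inter> V"
      then have "x \<in> (?T \<union> ?T') \<inter> V" using c1 by blast
      moreover have "x \<noteq> c" using x \<open>c \<notin> ?R\<close> by blast
      ultimately show "x \<in> {a, b, d}" unfolding TV by simp
    qed
    show "{a, b, d} \<subseteq> ?R \<inter> V" using V by (simp add: hull_inc)
  qed
  have "a \<notin> ?R'"
    using mem_triangle_iff[OF o(4), of a] o(3) cyc(1) orient_swap[of d b a] by auto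
  have RV': "?R' \<inter> V = {b, c, d}"
  proof
    show "?R' \<inter> V \<subseteq> {b, c, d}"
    proof
      fix x assume x: "x \<in> ?R' \<inter> V"
      then have "x \<in> (?T \<union> ?T') \<inter> V" using c3 by blast
      moreover have "x \<noteq> a" using x \<open>a \<notin> ?R'\<close> by blast
      ultimately show "x \<in> {b, c, d}" unfolding TV by simp
    qed
    show "{b, c, d} \<subseteq> ?R' \<inter> V" using V by (simp add: hull_inc)
  qed
  have clR: "clean_triangle V ?R" "clean_triangle V ?R'"
    using RV RV' o unfolding clean_triangle_def by blast+
  have RR: "interior ?R \<inter> interior ?R' = {}"
  proof (rule equals0I)
    fix x assume "x \<in> interior ?R \<inter> interior ?R'"
    then have "orient b d x > 0" "orient d b x > 0"
      using mem_interior_triangle_iff[OF o(3)] mem_interior_triangle_iff[OF o(4)] by auto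
    then show False using orient_swap[of b d x] by simp
  qed
  have "d \<notin> ?T"
    using mem_triangle_iff[OF T(2), of d] T'(2) orient_swap[of c a d] by auto
  moreover have "d \<in> ?T'" by (simp add: hull_inc)
  ultimately have TT': "?T \<noteq> ?T'" by metis
  have rest: "interior S \<inter> (?T \<union> ?T') = {}" if "S \<in> \<R>" for S
    using that dis[of S ?T] dis[of S ?T'] T(1) T'(1)
      open_disjoint_clean_triangle[OF cl[OF T(1)], of "interior S"]
      open_disjoint_clean_triangle[OF cl[OF T'(1)], of "interior S"]
    unfolding \<R>_def by blast
  define \<T>' where "\<T>' = insert ?R (insert ?R' \<R>)"
  have restR: "interior S \<inter> interior ?R = {}" "interior S \<inter> interior ?R' = {}" if "S \<in> \<R>" for S
    using rest[OF that] c1 c3 interior_subset[of ?R] interior_subset[of ?R'] by blast+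
  have "tiling V Q \<T>'"
    unfolding tiling_def
  proof (intro conjI ballI impI)
    show "finite \<T>'" using fin by (simp add: \<T>'_def \<R>_def)
    show "clean_triangle V S" if "S \<in> \<T>'" for S
      using that clR cl unfolding \<T>'_def \<R>_def by blast
    show "interior S \<inter> interior S' = {}" if "S \<in> \<T>'" "S' \<in> \<T>'" "S \<noteq> S'" for S S'
    proof -
      have "S \<in> \<R> \<Longrightarrow> S' \<in> \<R> \<Longrightarrow> ?thesis" using dis that(3) unfolding \<R>_def by blast
      then show ?thesis using that restR RR unfolding \<T>'_def by (metis Int_commute insertE)
    qed
    have "Q = ?T \<union> ?T' \<union> \<Union>\<R>" using un T(1) T'(1) unfolding \<R>_def by blast
    moreover have "?T \<union> ?T' = ?R \<union> ?R'"
      by (intro equalityI Un_least c1) (use c2 c3 c4 in \<open>simp_all add: Un_commute\<close>)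
    ultimately show "\<Union>\<T>' = Q" unfolding \<T>'_def by (simp add: Un_assoc)
  qed
  moreover have "(\<Sum>S\<in>\<T>'. weight V S) < (\<Sum>S\<in>\<T>. weight V S)"
  proof -
    have finR: "finite \<R>" using fin by (simp add: \<R>_def)
    have "\<T> = insert ?T (insert ?T' \<R>)" "?T \<notin> insert ?T' \<R>" "?T' \<notin> \<R>"
      using T(1) T'(1) TT' by (auto simp: \<R>_def)
    then have old: "(\<Sum>S\<in>\<T>. weight V S) = weight V ?T + (weight V ?T' + (\<Sum>S\<in>\<R>. weight V S))"
      using finR by (metis finite_insert sum.insert)
    have ins: "(\<Sum>S\<in>insert X \<X>. weight V S) \<le> weight V X + (\<Sum>S\<in>\<X>. weight V S)" if "finite \<X>" for X \<X>
      using that weight_nonneg[of V X] by (simp add: sum.insert_if)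
    have new: "(\<Sum>S\<in>\<T>'. weight V S) \<le> weight V ?R + (weight V ?R' + (\<Sum>S\<in>\<R>. weight V S))"
      unfolding \<T>'_def using ins[of "insert ?R' \<R>" ?R] ins[of \<R> ?R'] finR by simp
    have "weight V ?T + weight V ?T' - weight V ?R - weight V ?R' = - flip_defect a b c d / 2"
      using weight_triangle[OF T(2) refl T(3)] weight_triangle[OF T'(2) refl T'(3)]
        weight_triangle[OF o(3) refl RV] weight_triangle[OF o(4) refl RV'] flip_weight[of a b c d]
      by (simp add: field_simps)
    then show ?thesis using old new bad by linarith
  qed
  ultimately show ?thesis using that by blast
qed

definition delaunay_tiling :: "(real^2) set \<Rightarrow> (real^2) set \<Rightarrow> (real^2) set set \<Rightarrow> bool" where
  "delaunay_tiling V Q \<T> \<longleftrightarrow> tiling V Q \<T> \<and>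
     (\<forall>a b c d. convex hull {a, b, c} \<in> \<T> \<and> orient a b c > 0 \<and> convex hull {a, b, c} \<inter> V = {a, b, c} \<and>
        convex hull {a, c, d} \<in> \<T> \<and> orient a c d > 0 \<and> convex hull {a, c, d} \<inter> V = {a, c, d} \<longrightarrow>
        flip_defect a b c d \<ge> 0)"

text \<open>A tiling of least total weight admits no flip that lowers the weight.\<close>

lemma delaunay_tiling_exists:
  assumes V: "finite V" and ex: "tiling V Q \<T>0"
  obtains \<T> where "delaunay_tiling V Q \<T>"
proof -
  define U where "U = {\<T>. tiling V Q \<T>}"
  have "U \<subseteq> Pow {T. clean_triangle V T}" unfolding U_def tiling_def by auto
  then have "finite U" using finite_clean_triangles[OF V] by (meson finite_Pow_iff finite_subset)
  moreover have "U \<noteq> {}" using ex by (auto simp: U_def)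
  ultimately obtain \<T> where \<T>: "\<T> \<in> U"
    and max: "\<And>\<T>'. \<T>' \<in> U \<Longrightarrow> - (\<Sum>T\<in>\<T>'. weight V T) \<le> - (\<Sum>T\<in>\<T>. weight V T)"
    using finite_argmax[of U "\<lambda>\<T>. - (\<Sum>T\<in>\<T>. weight V T)"] by blast
  have til: "tiling V Q \<T>" using \<T> by (simp add: U_def)
  have "delaunay_tiling V Q \<T>"
    unfolding delaunay_tiling_def
  proof (intro conjI allI impI til)
    fix a b c d
    assume *: "convex hull {a, b, c} \<in> \<T> \<and> orient a b c > 0 \<and> convex hull {a, b, c} \<inter> V = {a, b, c} \<and>
        convex hull {a, c, d} \<in> \<T> \<and> orient a c d > 0 \<and> convex hull {a, c, d} \<inter> V = {a, c, d}"
    show "flip_defect a b c d \<ge> 0"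
    proof (rule ccontr)
      assume "\<not> flip_defect a b c d \<ge> 0"
      then have "flip_defect a b c d < 0" by simp
      then obtain \<T>' where "tiling V Q \<T>'" "(\<Sum>T\<in>\<T>'. weight V T) < (\<Sum>T\<in>\<T>. weight V T)"
        using flip_tiling[OF til] * by metis
      then show False using max[of \<T>'] by (simp add: U_def)
    qed
  qed
  then show ?thesis using that by blast
qed

section \<open>The triangle across an interior side\<close>

text \<open>The midpoint of the side is inner to \<open>Q\<close>. Points just beyond it are covered by tiles
that contain the midpoint, and such a tile has the whole segment as a side.\<close>

lemma neighbour_across_side:
  assumes til: "tiling V Q \<T>" and Q: "frontier Q = \<Union>E" and E: "\<And>e. e \<in> E \<Longrightarrow> clean_segment V e"
    and T: "convex hull {a, b, c} \<in> \<T>" "orient a b c > 0" "convex hull {a, b, c} \<inter> V = {a, b, c}"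
    and nE: "closed_segment a b \<notin> E"
  obtains d where "orient b a d > 0" "convex hull {b, a, d} \<in> \<T>" "convex hull {b, a, d} \<inter> V = {b, a, d}"
proof -
  let ?T = "convex hull {a, b, c}"
  have fin: "finite \<T>" and cl: "\<And>S. S \<in> \<T> \<Longrightarrow> clean_triangle V S" and un: "\<Union>\<T> = Q"
    and dis: "\<And>S S'. S \<in> \<T> \<Longrightarrow> S' \<in> \<T> \<Longrightarrow> S \<noteq> S' \<Longrightarrow> interior S \<inter> interior S' = {}"
    using til unfolding tiling_def by auto
  have ab: "a \<noteq> b" using T(2) by auto
  have seg: "closed_segment a b \<inter> V = {a, b}" using segment_Int_side_triangle[OF T(2,3)] .
  define m where "m = (1 - 1/2) *\<^sub>R a + (1/2) *\<^sub>R b"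
  have m: "m \<in> open_segment a b" unfolding m_def using ab by (intro mem_open_segmentI) auto
  then have mc: "m \<in> closed_segment a b" using segment_open_subset_closed by blast
  have mV: "m \<notin> V" using m mc seg by (auto simp: open_segment_def)
  have sT: "closed_segment a b \<subseteq> ?T" unfolding segment_convex_hull by (rule hull_mono) auto
  have "m \<notin> frontier Q"
  proof
    assume "m \<in> frontier Q"
    then obtain e where e: "e \<in> E" "m \<in> e" using Q by blast
    have "interior ?T \<subseteq> interior Q" using T(1) un by (intro interior_mono) blast
    moreover have "e \<inter> interior Q = {}" using e(1) Q by (auto simp: frontier_def)
    ultimately have "e \<inter> interior ?T = {}" by blast
    then have "e = closed_segment a b"
      using clean_segment_touching_side[OF T(2) seg E[OF e(1)] _ mc e(2) mV] by blast
    then show False using e(1) nE by simp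
  qed
  moreover have "m \<in> Q" using mc sT T(1) un by blast
  ultimately have mQ: "m \<in> interior Q" using closure_subset[of Q] by (auto simp: frontier_def)
  \<comment> \<open>Removing the tiles that miss \<open>m\<close> leaves a neighbourhood of \<open>m\<close> that only tiles through \<open>m\<close> can cover.\<close>
  define X where "X = \<Union>{S \<in> \<T>. m \<notin> S}"
  have "closed X" unfolding X_def using fin cl clean_triangle_properties(1) by (intro closed_Union) auto
  then have "open (interior Q - X)" by (intro open_Diff) auto
  moreover have "m \<in> interior Q - X" using mQ by (auto simp: X_def)
  ultimately obtain r where r: "r > 0" "ball m r \<subseteq> interior Q - X" using openE by blast
  have om: "orient a b m = 0" unfolding m_def orient_segment by simp
  have "m \<noteq> c" using om T(2) by auto
  define t where "t = r / (2 * norm (m - c))"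
  have t: "t > 0" using r(1) \<open>m \<noteq> c\<close> by (simp add: t_def)
  \<comment> \<open>A point close to \<open>m\<close> on the ray that leads away from \<open>c\<close>, written as an affine combination so that \<open>orient_segment\<close> applies.\<close>
  define y where "y = (1 - (- t)) *\<^sub>R m + (- t) *\<^sub>R c"
  have "m - y = - (t *\<^sub>R (m - c))" by (simp add: y_def algebra_simps)
  then have "dist m y = t * norm (m - c)" using t by (simp add: dist_norm)
  also have "\<dots> = r / 2" using \<open>m \<noteq> c\<close> by (simp add: t_def)
  finally have "y \<in> ball m r" using r(1) by simp
  then have y: "y \<in> Q" "y \<notin> X" using r(2) interior_subset by blast+
  then obtain T' where T': "T' \<in> \<T>" "y \<in> T'" "m \<in> T'" using un unfolding X_def by blast
  have oy: "orient a b y < 0" unfolding y_def orient_segment using om t T(2) by simp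
  have "y \<notin> ?T" using mem_triangle_iff[OF T(2), of y] oy by simp
  then have ne: "?T \<noteq> T'" using T'(2) by blast
  have "interior T' \<inter> ?T = {}"
    using open_disjoint_clean_triangle[OF cl[OF T(1)], of "interior T'"] dis[OF T(1) T'(1) ne] by blast
  then have "closed_segment a b \<inter> interior T' = {}" using sT by blast
  then obtain a' b' c' where abc': "orient a' b' c' > 0" "T' = convex hull {a', b', c'}" "T' \<inter> V = {a', b', c'}"
    "closed_segment a b = closed_segment a' b'"
    using clean_segment_touching_triangle[OF cl[OF T'(1)] clean_triangle_sides[OF T(2,3)] _ T'(3) mc mV] by blast
  have "closed_segment a' b' \<inter> V = {a', b'}" using segment_Int_side_triangle abc' by blast
  then have "{a, b} = {a', b'}" using seg abc'(4) by simp
  then consider "a' = a" "b' = b" | "a' = b" "b' = a" by (metis doubleton_eq_iff)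
  then show ?thesis
  proof cases
    case 1
    then have "orient a b y \<ge> 0" using T'(2) abc' mem_triangle_iff by blast
    then show ?thesis using oy by simp
  next
    case 2
    then show ?thesis using that[of c'] abc' T'(1) by simp
  qed
qed

section \<open>Propagation of thin triangles\<close>

text \<open>The cosine of the angle at \<open>b\<close> times the lengths of its two sides.\<close>

definition corner :: "real^2 \<Rightarrow> real^2 \<Rightarrow> real^2 \<Rightarrow> real" where
  "corner a b c = (a - b) \<bullet> (c - b)"

lemma dist_sq: "(dist x y)\<^sup>2 = (x - y) \<bullet> (x - y)"
  by (simp add: dist_norm power2_norm_eq_inner)

lemma law_of_cosines: "(dist a c)\<^sup>2 = (dist a b)\<^sup>2 + (dist b c)\<^sup>2 - 2 * corner a b c"
  by (simp add: dist_sq corner_def inner_diff_left inner_diff_right inner_commute algebra_simps)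

lemma orient_corner_sq: "(orient a b c)\<^sup>2 + (corner a b c)\<^sup>2 = (dist a b)\<^sup>2 * (dist b c)\<^sup>2"
  unfolding dist_sq orient_def corner_def inner_vec_def sum_2 by simp algebra

lemma orient_sq_corners:
  "(orient a b c)\<^sup>2 = corner c a b * corner a b c + corner a b c * corner b c a + corner b c a * corner c a b"
  unfolding orient_def corner_def inner_vec_def sum_2 by simp algebra

text \<open>Each corner value has absolute value at least \<open>1/2\<close> by
\<open>orient_corner_sq\<close>. If all were positive, then \<open>orient_sq_corners\<close> would make the
triangle thick.\<close>

lemma thin_triangle_obtuse:
  assumes d: "dist a b \<ge> 1" "dist b c \<ge> 1" "dist c a \<ge> 1" and thin: "0 < orient a b c" "orient a b c < 1/2"
  shows "corner c a b \<le> -1/2 \<or> corner a b c \<le> -1/2 \<or> corner b c a \<le> -1/2"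
proof (rule ccontr)
  assume neg: "\<not> ?thesis"
  have A: "(orient a b c)\<^sup>2 < 1/4"
    using power_strict_mono[OF thin(2), of 2] thin(1) by (simp add: power2_eq_square)
  have big: "k \<ge> 1/2" if "o1\<^sup>2 + k\<^sup>2 = x\<^sup>2 * y\<^sup>2" "o1\<^sup>2 < 1/4" "x \<ge> 1" "y \<ge> 1" "\<not> k \<le> -1/2" for o1 k x y :: real
  proof (rule ccontr)
    assume "\<not> k \<ge> 1/2"
    then have "\<bar>k\<bar> < 1/2" using that(5) by linarith
    then have "k\<^sup>2 < 1/4" using power_strict_mono[of "\<bar>k\<bar>" "1/2" 2] by (simp add: power2_eq_square)
    moreover have "1 * 1 \<le> x\<^sup>2 * y\<^sup>2" using that(3,4) by (intro mult_mono) auto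
    ultimately show False using that(1,2) by linarith
  qed
  have "corner a b c \<ge> 1/2" using big[OF orient_corner_sq[of a b c] A d(1,2)] neg by blast
  moreover have "corner b c a \<ge> 1/2"
    using big[OF orient_corner_sq[of b c a] _ d(2,3)] A neg by (simp add: orient_cycle[of b c a])
  moreover have "corner c a b \<ge> 1/2"
    using big[OF orient_corner_sq[of c a b] _ d(3,1)] A neg by (simp add: orient_cycle[of c a b] orient_cycle[of b c a])
  ultimately have "1/2 * (1/2) \<le> corner c a b * corner a b c" "1/2 * (1/2) \<le> corner a b c * corner b c a"
    "1/2 * (1/2) \<le> corner b c a * corner c a b"
    by (intro mult_mono; linarith)+
  then show False using A orient_sq_corners[of a b c] by linarith
qed

text \<open>Crossing the longest side of a thin triangle leads to a thin triangle with a side longer than all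
sides before, as long as the thinness allows for \<open>k\<close> further steps. The increase is measured by
the squares of the lengths, which grow by at least one each time.\<close>

lemma thin_triangles_propagate:
  fixes N :: real
  assumes del: "delaunay_tiling V Q \<T>" and Q: "frontier Q = \<Union>E" and E: "\<And>e. e \<in> E \<Longrightarrow> clean_segment V e"
    and unit: "\<And>a b. closed_segment a b \<in> E \<Longrightarrow> dist a b = 1"
    and far: "\<And>v w. v \<in> V \<Longrightarrow> w \<in> V \<Longrightarrow> v \<noteq> w \<Longrightarrow> dist v w \<ge> 1"
    and near: "\<And>v w. v \<in> V \<Longrightarrow> w \<in> V \<Longrightarrow> dist v w \<le> N" and N: "N \<ge> 1"
  shows "convex hull {a, b, c} \<in> \<T> \<Longrightarrow> orient a b c > 0 \<Longrightarrow> convex hull {a, b, c} \<inter> V = {a, b, c} \<Longrightarrow>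
    orient a b c * (2 * N\<^sup>2) ^ k < 1/2 \<Longrightarrow> x \<in> {a, b, c} \<Longrightarrow> y \<in> {a, b, c} \<Longrightarrow>
    \<exists>v\<in>V. \<exists>w\<in>V. (dist v w)\<^sup>2 \<ge> (dist x y)\<^sup>2 + real k"
proof (induction k arbitrary: a b c x y)
  case 0
  then have "x \<in> V" "y \<in> V" by blast+
  then show ?case by auto
next
  case (Suc k)
  have til: "tiling V Q \<T>" using del by (simp add: delaunay_tiling_def)
  have N1: "2 * N\<^sup>2 \<ge> 1" using one_le_power[OF N, of 2] by simp
  \<comment> \<open>The triangle may be relabelled cyclically so that the obtuse corner is the second vertex.\<close>
  have key: "\<exists>v\<in>V. \<exists>w\<in>V. (dist v w)\<^sup>2 \<ge> (dist x y)\<^sup>2 + real (Suc k)"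
    if T: "convex hull {a, b, c} \<in> \<T>" "orient a b c > 0" "convex hull {a, b, c} \<inter> V = {a, b, c}"
      and thin: "orient a b c * (2 * N\<^sup>2) ^ Suc k < 1/2" and xy: "x \<in> {a, b, c}" "y \<in> {a, b, c}"
      and obt: "corner a b c \<le> -1/2" for a b c x y
  proof -
    have V: "a \<in> V" "b \<in> V" "c \<in> V" using T(3) by blast+
    have "a \<noteq> b" "b \<noteq> c" "a \<noteq> c" using T(2) by auto
    then have d1: "dist a b \<ge> 1" "dist b c \<ge> 1" "dist a c \<ge> 1" using far V by auto
    have sq1: "(dist a b)\<^sup>2 \<ge> 1" "(dist b c)\<^sup>2 \<ge> 1" using d1 by auto
    have ac: "(dist a c)\<^sup>2 \<ge> (dist a b)\<^sup>2 + (dist b c)\<^sup>2 + 1" using law_of_cosines[of a c b] obt by linarith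
    \<comment> \<open>Opposite to an obtuse corner, the side is longer than an edge.\<close>
    have "closed_segment c a \<notin> E"
    proof
      assume "closed_segment c a \<in> E"
      then have "dist a c = 1" using unit by (metis dist_commute)
      then show False using ac sq1 by simp
    qed
    moreover have rot: "{c, a, b} = {a, b, c}" by auto
    moreover have "orient c a b > 0" using T(2) by (simp add: orient_cycle[of c a b] orient_cycle[of b c a])
    ultimately obtain d where T': "orient a c d > 0" "convex hull {a, c, d} \<in> \<T>" "convex hull {a, c, d} \<inter> V = {a, c, d}"
      using neighbour_across_side[OF til Q E, of c a b] T by auto
    have dV: "d \<in> V" using T'(3) by blast
    have "a \<noteq> d" "c \<noteq> d" using T'(1) by auto
    then have d2: "dist a d \<ge> 1" "dist c d \<ge> 1" "dist d a \<ge> 1" using far V dV by (auto simp: dist_commute)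
    have "flip_defect a b c d \<ge> 0" using del T T' unfolding delaunay_tiling_def by blast
    then have fd: "orient a b c * corner a d c + orient a c d * corner a b c \<ge> 0"
      by (simp add: flip_defect_def corner_def)
    \<comment> \<open>The obtuse corner at \<open>b\<close> forces the angle at \<open>d\<close> to be acute and the triangle \<open>a c d\<close> to be thin.\<close>
    have "orient a c d * corner a b c \<le> orient a c d * (-1/2)" using obt T'(1) by (intro mult_left_mono) auto
    then have fd2: "orient a c d / 2 \<le> orient a b c * corner a d c" using fd by linarith
    then have "orient a b c * corner a d c > 0" using T'(1) by linarith
    then have dpos: "corner a d c > 0" using T(2) by (simp add: zero_less_mult_iff)
    have "corner a d c \<le> norm (a - d) * norm (c - d)" unfolding corner_def by (rule norm_cauchy_schwarz)
    also have "\<dots> \<le> N * N" using near[OF V(1) dV] near[OF V(3) dV] N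
      by (intro mult_mono) (auto simp: dist_norm)
    finally have "orient a b c * corner a d c \<le> orient a b c * N\<^sup>2"
      using T(2) by (intro mult_left_mono) (auto simp: power2_eq_square)
    then have small: "orient a c d \<le> orient a b c * (2 * N\<^sup>2)" using fd2 by simp
    have "orient a c d * (2 * N\<^sup>2) ^ k \<le> orient a b c * (2 * N\<^sup>2) * (2 * N\<^sup>2) ^ k"
      using small N1 by (intro mult_right_mono) auto
    also have "\<dots> < 1/2" using thin by (simp add: mult.assoc)
    finally have thin': "orient a c d * (2 * N\<^sup>2) ^ k < 1/2" .
    have "orient a c d \<le> orient a c d * (2 * N\<^sup>2) ^ k"
      using T'(1) one_le_power[OF N1, of k] by simp
    then have "orient a c d < 1/2" using thin' by linarith
    moreover have "corner c d a = corner a d c" by (simp add: corner_def inner_commute)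
    ultimately have obt': "corner d a c \<le> -1/2 \<or> corner a c d \<le> -1/2"
      using thin_triangle_obtuse[of a c d] d1 d2 T'(1) dpos by auto
    have "(dist c d)\<^sup>2 \<ge> (dist a c)\<^sup>2 + 1 \<or> (dist a d)\<^sup>2 \<ge> (dist a c)\<^sup>2 + 1"
    proof -
      have "(dist d a)\<^sup>2 \<ge> 1" "(dist c d)\<^sup>2 \<ge> 1" using d2 by auto
      then have "corner d a c \<le> -1/2 \<Longrightarrow> (dist d c)\<^sup>2 \<ge> (dist a c)\<^sup>2 + 1"
        "corner a c d \<le> -1/2 \<Longrightarrow> (dist a d)\<^sup>2 \<ge> (dist a c)\<^sup>2 + 1"
        using law_of_cosines[of d c a] law_of_cosines[of a d c] by linarith+
      then show ?thesis using obt' by (auto simp: dist_commute)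
    qed
    moreover have "(dist a c)\<^sup>2 \<ge> (dist x y)\<^sup>2"
    proof -
      have "(dist x y)\<^sup>2 = 0 \<or> (dist x y)\<^sup>2 = (dist a b)\<^sup>2 \<or> (dist x y)\<^sup>2 = (dist b c)\<^sup>2 \<or> (dist x y)\<^sup>2 = (dist a c)\<^sup>2"
        using xy by (auto simp: dist_commute)
      then show ?thesis using ac sq1 by linarith
    qed
    ultimately obtain z where z: "z \<in> {a, c}" "(dist z d)\<^sup>2 \<ge> (dist x y)\<^sup>2 + 1" by fastforce
    then have "z \<in> {a, c, d}" "d \<in> {a, c, d}" by auto
    then obtain v w where "v \<in> V" "w \<in> V" "(dist v w)\<^sup>2 \<ge> (dist z d)\<^sup>2 + real k"
      using Suc.IH[OF T'(2,1,3) thin'] by metis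
    then show ?thesis using z(2) by (intro bexI[of _ v] bexI[of _ w]) auto
  qed
  have T: "convex hull {a, b, c} \<in> \<T>" "orient a b c > 0" "convex hull {a, b, c} \<inter> V = {a, b, c}"
    "orient a b c * (2 * N\<^sup>2) ^ Suc k < 1/2" using Suc.prems by auto
  have V: "a \<in> V" "b \<in> V" "c \<in> V" using T(3) by blast+
  have "a \<noteq> b" "b \<noteq> c" "c \<noteq> a" using T(2) by auto
  then have d1: "dist a b \<ge> 1" "dist b c \<ge> 1" "dist c a \<ge> 1" using far V by auto
  have "orient a b c \<le> orient a b c * (2 * N\<^sup>2) ^ Suc k"
    using T(2) one_le_power[OF N1, of "Suc k"] by simp
  then have "orient a b c < 1/2" using T(4) by linarith
  then consider "corner c a b \<le> -1/2" | "corner a b c \<le> -1/2" | "corner b c a \<le> -1/2"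
    using thin_triangle_obtuse[OF d1 T(2)] by blast
  then show ?case
  proof cases
    case 1
    have "{c, a, b} = {a, b, c}" by auto
    then show ?thesis using key[of c a b x y] T 1 Suc.prems(5,6) by (simp add: orient_cycle[of c a b] orient_cycle[of b c a])
  next
    case 2
    then show ?thesis using key[of a b c x y] T Suc.prems(5,6) by simp
  next
    case 3
    have "{b, c, a} = {a, b, c}" by auto
    then show ?thesis using key[of b c a x y] T 3 Suc.prems(5,6) by (simp add: orient_cycle[of b c a])
  qed
qed

section \<open>Diameter and angle bounds\<close>

text \<open>The projection to the line through \<open>v\<close> and \<open>w\<close> is connected, so an
interval of length \<open>dist v w\<close> is covered by \<open>card E\<close> intervals of length at most
one.\<close>

lemma connected_union_of_segments_diameter:
  fixes E :: "'a::euclidean_space set set"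
  assumes fin: "finite E" and con: "connected (\<Union>E)"
    and seg: "\<And>e. e \<in> E \<Longrightarrow> \<exists>a b. e = closed_segment a b \<and> dist a b \<le> 1"
    and v: "v \<in> \<Union>E" and w: "w \<in> \<Union>E"
  shows "dist v w \<le> real (card E)"
proof (cases "v = w")
  case False
  define u where "u = (w - v) /\<^sub>R norm (w - v)"
  define f where "f = (\<lambda>z. u \<bullet> z)"
  have nu: "norm u = 1" using False by (simp add: u_def)
  have lin: "linear f" unfolding f_def by (simp add: linear_iff inner_add_right)
  have "u \<bullet> (w - v) = norm (w - v)"
    using False by (simp add: u_def dot_square_norm power2_eq_square)
  then have fvw: "f w - f v = dist v w" by (simp add: f_def inner_diff_right dist_norm norm_minus_commute)
  have "connected (f ` \<Union>E)"
    using con unfolding f_def by (intro connected_continuous_image continuous_intros)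
  then have "{f v..f w} \<subseteq> f ` \<Union>E" using v w by (intro connected_contains_Icc) auto
  then have cover: "{f v..f w} \<subseteq> (\<Union>e\<in>E. f ` e)" by blast
  have img: "f ` e \<in> fmeasurable lborel \<and> measure lborel (f ` e) \<le> 1" if e: "e \<in> E" for e
  proof -
    obtain a b where ab: "e = closed_segment a b" "dist a b \<le> 1" using seg[OF e] by blast
    have im: "f ` e = closed_segment (f a) (f b)" unfolding ab(1) using closed_segment_linear_image[OF lin] by simp
    have "\<bar>f a - f b\<bar> = \<bar>u \<bullet> (a - b)\<bar>" by (simp add: f_def inner_diff_right)
    also have "\<dots> \<le> norm u * norm (a - b)" by (rule Cauchy_Schwarz_ineq2)
    also have "\<dots> \<le> 1" using ab(2) nu by (simp add: dist_norm)
    finally have "\<bar>f a - f b\<bar> \<le> 1" .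
    then show ?thesis unfolding im closed_segment_eq_real_ivl by (auto simp: fmeasurable_def)
  qed
  have "dist v w = measure lborel {f v..f w}" using fvw by (simp add: dist_nz less_imp_le) (metis diff_ge_0_iff_ge fvw zero_le_dist)
  also have "\<dots> \<le> measure lborel (\<Union>e\<in>E. f ` e)"
    using cover img fin by (intro measure_mono_fmeasurable fmeasurable.finite_UN) auto
  also have "\<dots> \<le> (\<Sum>e\<in>E. measure lborel (f ` e))"
    using img fin by (intro measure_UNION_le) (auto simp: fmeasurable_def)
  also have "\<dots> \<le> (\<Sum>e\<in>E. 1)" using img by (intro sum_mono) auto
  finally show ?thesis by simp
qed simp

text \<open>The sine of the angle at \<open>b\<close> is \<open>orient a b c\<close> divided by the lengths of
the adjacent sides, up to sign.\<close>

lemma angle_bound_from_area: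
  assumes d: "1 \<le> dist a b" "dist a b \<le> N" "1 \<le> dist b c" "dist b c \<le> N"
    and k: "0 < k" "k \<le> \<bar>orient a b c\<bar>"
  shows "arccos (sqrt (1 - k\<^sup>2 / N ^ 4)) \<le> angle_at a b c"
proof -
  define P where "P = dist a b * dist b c"
  have P: "1 \<le> P" "P \<le> N\<^sup>2"
  proof -
    show "1 \<le> P" unfolding P_def using mult_mono[of 1 "dist a b" 1 "dist b c"] d by simp
    show "P \<le> N\<^sup>2" unfolding P_def power2_eq_square using d by (intro mult_mono) auto
  qed
  have ang: "angle_at a b c = arccos (corner a b c / P)"
    by (simp add: angle_at_def corner_def P_def dist_norm norm_minus_commute)
  have "(orient a b c)\<^sup>2 + (corner a b c)\<^sup>2 = P\<^sup>2"
    using orient_corner_sq[of a b c] by (simp add: P_def power_mult_distrib)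
  then have "(corner a b c / P)\<^sup>2 = 1 - (orient a b c)\<^sup>2 / P\<^sup>2"
    using P(1) by (simp add: power_divide field_simps)
  moreover have "k\<^sup>2 / N ^ 4 \<le> (orient a b c)\<^sup>2 / P\<^sup>2"
  proof (rule frac_le)
    show "k\<^sup>2 \<le> (orient a b c)\<^sup>2" using k power_mono[of k "\<bar>orient a b c\<bar>" 2] by simp
    show "0 < P\<^sup>2" using P by simp
    have "P\<^sup>2 \<le> (N\<^sup>2)\<^sup>2" using P by (intro power_mono) auto
    then show "P\<^sup>2 \<le> N ^ 4" by simp
  qed simp
  ultimately have sq: "(corner a b c / P)\<^sup>2 \<le> 1 - k\<^sup>2 / N ^ 4" by linarith
  then have le: "\<bar>corner a b c / P\<bar> \<le> sqrt (1 - k\<^sup>2 / N ^ 4)" by (intro real_le_rsqrt) (simp only: power2_abs)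
  moreover have "sqrt (1 - k\<^sup>2 / N ^ 4) \<le> 1" by simp
  ultimately show ?thesis unfolding ang by (intro arccos_le_arccos) linarith+
qed

text \<open>If twice its area were below \<open>1 / (2 * (2 * n\<^sup>2) ^ (n\<^sup>2 + 1))\<close>, a
triangle would be thin enough for the \<open>n\<^sup>2 + 1\<close> steps of
\<open>thin_triangles_propagate\<close>, and the last side would exceed the diameter \<open>n\<close>.\<close>

lemma delaunay_tiling_angle_bound:
  fixes n :: nat
  assumes n: "n \<ge> 1" and del: "delaunay_tiling V Q \<T>" and Q: "frontier Q = \<Union>E"
    and E: "\<And>e. e \<in> E \<Longrightarrow> clean_segment V e"
    and unit: "\<And>a b. closed_segment a b \<in> E \<Longrightarrow> dist a b = 1"
    and far: "\<And>v w. v \<in> V \<Longrightarrow> w \<in> V \<Longrightarrow> v \<noteq> w \<Longrightarrow> dist v w \<ge> 1"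
    and near: "\<And>v w. v \<in> V \<Longrightarrow> w \<in> V \<Longrightarrow> dist v w \<le> real n"
    and T: "T \<in> \<T>" "T = convex hull {a, b, c}"
  shows "arccos (sqrt (1 - (1 / (2 * (2 * (real n)\<^sup>2) ^ (n\<^sup>2 + 1)))\<^sup>2 / real n ^ 4)) \<le> angle_at a b c"
proof -
  define M where "M = (2 * (real n)\<^sup>2) ^ (n\<^sup>2 + 1)"
  have M: "M > 0" using n by (simp add: M_def)
  have "clean_triangle V T" using del T(1) unfolding delaunay_tiling_def tiling_def by blast
  then obtain a' b' c' where abc': "orient a' b' c' > 0" "T = convex hull {a', b', c'}" "T \<inter> V = {a', b', c'}"
    by (rule clean_triangleE)
  have "a' \<in> V" using abc'(3) by blast
  have big: "orient a' b' c' \<ge> 1 / (2 * M)"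
  proof (rule ccontr)
    assume "\<not> ?thesis"
    then have "orient a' b' c' * M < 1/2" using M by (simp add: field_simps)
    then obtain v w where vw: "v \<in> V" "w \<in> V" "(dist v w)\<^sup>2 \<ge> (dist a' a')\<^sup>2 + real (n\<^sup>2 + 1)"
      using thin_triangles_propagate[OF del Q E unit far near, of a' b' c' "n\<^sup>2 + 1" a' a']
        n abc' T(1) unfolding M_def by auto
    moreover have "(dist v w)\<^sup>2 \<le> (real n)\<^sup>2" using near[OF vw(1,2)] by (intro power_mono) auto
    ultimately show False by simp
  qed
  \<comment> \<open>Both labellings give the same area, whatever the order of the corners.\<close>
  have "\<bar>orient a b c\<bar> = orient a' b' c'"
    using measure_triangle_orient[of a b c] measure_triangle_orient[of a' b' c'] T(2) abc' by simp
  then have area: "1 / (2 * M) \<le> \<bar>orient a b c\<bar>" using big by simp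
  have "orient a b c \<noteq> 0" using area M by (metis abs_zero divide_pos_pos less_le_not_le mult_pos_pos zero_less_numeral zero_less_one)
  then have ind: "\<not> affine_dependent {a, b, c}" "\<not> affine_dependent {a', b', c'}"
    using triangle_affine_independent abc'(1) by auto
  have "x \<in> {a, b, c} \<longleftrightarrow> x \<in> {a', b', c'}" for x
    using extreme_point_of_convex_hull_affine_independent[OF ind(1), of x]
      extreme_point_of_convex_hull_affine_independent[OF ind(2), of x] T(2) abc'(2) by simp
  then have "{a, b, c} \<subseteq> V" using abc'(3) by blast
  moreover have "a \<noteq> b" "b \<noteq> c" using \<open>orient a b c \<noteq> 0\<close> by auto
  ultimately show ?thesis
    using angle_bound_from_area[of a b "real n" c "1 / (2 * M)"] far near area M unfolding M_def by auto
qed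

text \<open>A further vertex on a unit edge would be closer than one to an end point.\<close>

lemma clean_edges_of_polygon:
  assumes unit: "\<And>a b. closed_segment a b \<in> E \<Longrightarrow> dist a b = 1"
    and far: "\<And>v w. v \<in> segment_endpoints E \<Longrightarrow> w \<in> segment_endpoints E \<Longrightarrow> v \<noteq> w \<Longrightarrow> dist v w \<ge> 1"
    and e: "closed_segment a b \<in> E"
  shows "closed_segment a b \<inter> segment_endpoints E = {a, b}" "clean_segment (segment_endpoints E) (closed_segment a b)"
proof -
  have V: "a \<in> segment_endpoints E" "b \<in> segment_endpoints E"
    using e closed_segment_commute[of a b] unfolding segment_endpoints_def by (auto, metis)
  have "v = a \<or> v = b" if v: "v \<in> closed_segment a b" "v \<in> segment_endpoints E" for v
  proof (rule ccontr)
    assume "\<not> ?thesis"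
    then have "dist a v \<ge> 1" "dist v b \<ge> 1" using far V v(2) by auto
    moreover have "dist a b = dist a v + dist v b"
      using v(1) between_mem_segment[of a b v] between[of a b v] by simp
    ultimately show False using unit[OF e] by simp
  qed
  then show *: "closed_segment a b \<inter> segment_endpoints E = {a, b}" using V by auto
  have "a \<noteq> b" using unit[OF e] by auto
  then show "clean_segment (segment_endpoints E) (closed_segment a b)"
    using V * unfolding clean_segment_def by blast
qed

lemma finite_segment_endpoints:
  assumes "finite E"
  shows "finite (segment_endpoints E)"
proof -
  have "finite {a. \<exists>b. closed_segment a b = e}" for e :: "(real^2) set"
  proof (cases "\<exists>p q. e = closed_segment p q")
    case True
    then obtain p q where e: "e = closed_segment p q" by blast
    have "{a. \<exists>b. closed_segment a b = e} \<subseteq> {p, q}"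
      unfolding e closed_segment_eq by (auto simp: doubleton_eq_iff)
    then show ?thesis by (rule finite_subset) simp
  next
    case False
    then have "{a. \<exists>b. closed_segment a b = e} = {}" by blast
    then show ?thesis by simp
  qed
  moreover have "segment_endpoints E = (\<Union>e\<in>E. {a. \<exists>b. closed_segment a b = e})"
    unfolding segment_endpoints_def by blast
  ultimately show ?thesis using assms by simp
qed

theorem theorem3p3:
  fixes n :: nat
  assumes "n \<ge> 3"
  shows "\<exists>\<theta>::real. \<theta> > 0 \<and>
    (\<forall>Q E. n_polygon n Q E \<longrightarrow>
       (\<forall>a b. closed_segment a b \<in> E \<longrightarrow> dist a b = 1) \<longrightarrow>
       (\<forall>v\<in>segment_endpoints E. \<forall>w\<in>segment_endpoints E. v \<noteq> w \<longrightarrow> dist v w \<ge> 1) \<longrightarrow>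
       (\<exists>\<T>. diagonal_triangulation Q E \<T> \<and>
          (\<forall>T\<in>\<T>. \<forall>a b c. T = convex hull {a, b, c} \<longrightarrow> angle_at a b c \<ge> \<theta>)))"
proof -
  define \<theta> where "\<theta> = arccos (sqrt (1 - (1 / (2 * (2 * (real n)\<^sup>2) ^ (n\<^sup>2 + 1)))\<^sup>2 / real n ^ 4))"
  have "\<theta> > 0"
  proof -
    define z where "z = (1 / (2 * (2 * (real n)\<^sup>2) ^ (n\<^sup>2 + 1)))\<^sup>2 / real n ^ 4"
    have z: "z > 0" using assms by (simp add: z_def)
    have "z \<le> 1"
    proof -
      have "(1::real) \<le> 2 * (real n)\<^sup>2" "(1::real) \<le> real n ^ 4"
        using assms one_le_power[of "real n" 2] one_le_power[of "real n" 4] by linarith+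
      then have "1 \<le> 2 * (2 * (real n)\<^sup>2) ^ (n\<^sup>2 + 1)"
        using one_le_power[of "2 * (real n)\<^sup>2" "n\<^sup>2 + 1"] by linarith
      then have "1 / (2 * (2 * (real n)\<^sup>2) ^ (n\<^sup>2 + 1)) \<le> 1" by simp
      then have "(1 / (2 * (2 * (real n)\<^sup>2) ^ (n\<^sup>2 + 1)))\<^sup>2 \<le> 1" by (intro power_le_one) auto
      then show ?thesis unfolding z_def using \<open>1 \<le> real n ^ 4\<close>
        by (simp add: divide_le_eq)
    qed
    then have "0 \<le> sqrt (1 - z)" "sqrt (1 - z) < 1" using z by auto
    then have "arccos 1 < arccos (sqrt (1 - z))" by (intro arccos_less_arccos; linarith)
    then show ?thesis by (simp add: \<theta>_def z_def)
  qed
  moreover have "\<exists>\<T>. diagonal_triangulation Q E \<T> \<and> (\<forall>T\<in>\<T>. \<forall>a b c. T = convex hull {a, b, c} \<longrightarrow> angle_at a b c \<ge> \<theta>)"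
    if poly: "n_polygon n Q E" and unit': "\<forall>a b. closed_segment a b \<in> E \<longrightarrow> dist a b = 1"
      and far': "\<forall>v\<in>segment_endpoints E. \<forall>w\<in>segment_endpoints E. v \<noteq> w \<longrightarrow> dist v w \<ge> 1" for Q E
  proof -
    define V where "V = segment_endpoints E"
    have unit: "\<And>a b. closed_segment a b \<in> E \<Longrightarrow> dist a b = 1" using unit' by blast
    have far: "\<And>v w. v \<in> V \<Longrightarrow> w \<in> V \<Longrightarrow> v \<noteq> w \<Longrightarrow> dist v w \<ge> 1" using far' unfolding V_def by blast
    have Q: "bounded Q" "Q = closure (interior Q)" "frontier Q = \<Union>E"
      and E: "finite E" "card E = n" and seg: "\<And>e. e \<in> E \<Longrightarrow> \<exists>a b. a \<noteq> b \<and> e = closed_segment a b"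
      and dis: "\<And>e e'. e \<in> E \<Longrightarrow> e' \<in> E \<Longrightarrow> e \<noteq> e' \<Longrightarrow> rel_interior e \<inter> rel_interior e' = {}"
      using poly unfolding n_polygon_def by metis+
    obtain g :: "real^2 \<Rightarrow> real^2" where g: "continuous_on (sphere 0 1) g" "g ` sphere 0 1 = frontier Q"
      using poly unfolding n_polygon_def topological_immersion_on_def by metis
    have "connected (sphere (0::real^2) 1)" by (simp add: connected_sphere_eq)
    then have con: "connected (\<Union>E)" using connected_continuous_image[OF g(1)] g(2) Q(3) by simp
    have clean: "clean_segment V e" if "e \<in> E" for e
      using seg[OF that] clean_edges_of_polygon(2)[OF unit far[unfolded V_def]] that unfolding V_def by blast
    have VE: "V \<subseteq> \<Union>E" unfolding V_def segment_endpoints_def by fastforce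
    have finV: "finite V" unfolding V_def using finite_segment_endpoints[OF E(1)] .
    have nc: "e \<inter> e' \<subseteq> V" if e: "e \<in> E" "e' \<in> E" "e \<noteq> e'" for e e'
    proof
      fix x assume x: "x \<in> e \<inter> e'"
      show "x \<in> V"
      proof (rule ccontr)
        assume "x \<notin> V"
        have "x \<in> rel_interior s" if s: "s \<in> E" "x \<in> s" for s
        proof -
          obtain v w where "v \<noteq> w" "s = closed_segment v w" "x \<in> open_segment v w"
            using clean_segment_interior_point[OF clean[OF s(1)] s(2) \<open>x \<notin> V\<close>] by metis
          then show ?thesis by (simp add: rel_interior_closed_segment)
        qed
        then show False using dis[OF e] e(1,2) x by blast
      qed
    qed
    have near: "dist v w \<le> real n" if "v \<in> V" "w \<in> V" for v w
    proof -
      have "\<exists>a b. e = closed_segment a b \<and> dist a b \<le> 1" if "e \<in> E" for e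
        using seg[OF that] unit that by fastforce
      then show ?thesis
        using connected_union_of_segments_diameter[OF E(1) con, of v w] VE that E(2) by blast
    qed
    obtain \<T>0 where "tiling V Q \<T>0" using tiling_exists[OF finV E(1) clean VE nc Q] .
    then obtain \<T> where del: "delaunay_tiling V Q \<T>" using delaunay_tiling_exists[OF finV] by blast
    then have "diagonal_triangulation Q E \<T>"
      unfolding delaunay_tiling_def V_def by (blast intro: tiling_diagonal_triangulation)
    moreover have "angle_at a b c \<ge> \<theta>" if "T \<in> \<T>" "T = convex hull {a, b, c}" for T a b c
      unfolding \<theta>_def using delaunay_tiling_angle_bound[OF _ del Q(3) clean unit far near that] assms by simp
    ultimately show ?thesis by blast
  qed
  ultimately show ?thesis by blast
qed

end
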